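(* Let $\mathcal{A}=\{1,\dots,N\}$, $\mathcal{C}=\{1,\dots,K\}$. Let each agent $i\in\mathcal{A}$ obey $$\dot x_i=-\alpha_i\nabla_{x_i}L_i(x_i,\lambda_i,\mu_i)+\alpha_iu_i,\quad \dot\lambda_{il}=\begin{cases}0&\text{if }\lambda_{il}=0\text{ and }g_{il}(x_i)<0\\ g_{il}(x_i)&\text{otherwise}\end{cases},\quad \dot\mu_{ij}=h_{ij}(x_i),\quad y_i=x_i,$$ for $l\in\mathcal{C}_{\mathrm{in},i}$, $j\in\mathcal{C}_{\mathrm{eq},i}$, with $\alpha_i>0$, $f_i$ and $g_{il}$ convex and $h_{ij}$ affine, and let each controller $k\in\mathcal{C}$ obey $\dot z_k=\beta_k\zeta_k$, $d_k=z_k+\beta_k\zeta_k$ with $\beta_k>0$. Let them be interconnected by $\zeta=(E\otimes I_n)^\top y$, $u=-(E\otimes I_n)d$, where $E\in\mathbb{R}^{N\times K}$ fulfills $\ker(E^\top)=\{\alpha1_N\mid\alpha\in\mathbb{R}\}$. If the sum of all objective functions $\sum_{i\in\mathcal{A}}f_i$ is strictly convex and $\lambda_{il}(0)\ge0$ for all $i,l$, then the equilibrium $\bar y_i=\mathrm{y}^*$, $i\in\mathcal{A}$, is globally asymptotically stable, where $\mathrm{y}^*$ is the minimizer of the constrained problem.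
   Context: Constrained problem: $\min_{\mathrm{y}\in\mathbb{R}^n}\sum_{i\in\mathcal{A}}f_i(\mathrm{y})$ subject to $g_{il}(\mathrm{y})\le0$ for $l\in\mathcal{C}_{\mathrm{in},i}$, $h_{ij}(\mathrm{y})=a_{ij}^\top\mathrm{y}+c_{ij}=0$ for $j\in\mathcal{C}_{\mathrm{eq},i}$, all $i\in\mathcal{A}$ (finite index sets). Standing assumptions: all functions are differentiable; Slater's condition holds (there is a point with all $h_{ij}=0$ and all $g_{il}<0$); a minimizer $\mathrm{y}^*$ exists (unique by strict convexity); and all $f_i$, $g_{il}$, $h_{ij}$ are Lipschitz (assumed in order that the closed-loop system has a unique continuous solution). Lagrange function of agent $i$: $L_i(x_i,\lambda_i,\mu_i)=f_i(x_i)+\sum_l\lambda_{il}g_{il}(x_i)+\sum_j\mu_{ij}h_{ij}(x_i)$, with $\lambda_i=\mathrm{col}(\lambda_{il})$, $\mu_i=\mathrm{col}(\mu_{ij})$. Solutions of the discontinuous closed-loop system are understood in the Carathéodory sense (absolutely continuous, satisfying the differential equation for almost every $t$). Stacked variables: $y=\mathrm{col}(y_i)$, $u=\mathrm{col}(u_i)$, $\zeta=\mathrm{col}(\zeta_k)$, $d=\mathrm{col}(d_k)$; $x_i,u_i,y_i,z_k,\zeta_k,d_k\in\mathbb{R}^n$. The full closed-loop state is $(x,\lambda,\mu,z)$, and equilibria are in general not unique, but all of them satisfy $\bar y_i=\mathrm{y}^*$. Global asymptotic stability of $\bar y_i=\mathrm{y}^*$ means: the equilibria of the closed-loop system (with $\bar\lambda\ge0$)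 are Lyapunov stable with respect to initial states with $\lambda(0)\ge0$, and along every solution with $\lambda(0)\ge0$ one has $y_i(t)\to\mathrm{y}^*$ as $t\to\infty$ for all $i\in\mathcal{A}$.
   Formalization: Solutions are required to satisfy λ_il(t) ≥ 0 for all t ≥ 0, not only λ_il(0) ≥ 0: a Carathéodory solution may otherwise slip from λ = 0 to negative values when g < 0 and converge to a point other than y* (e.g. f = sqrt(1+x²), g = x − 1). *)

theory Defs
  imports "HOL-Analysis.Analysis"
begin

subsection \<open>Convex optimization\<close>

definition strictly_convex_on :: "'b::real_vector set \<Rightarrow> ('b \<Rightarrow> real) \<Rightarrow> bool" where
  "strictly_convex_on S F \<longleftrightarrow> convex S \<and>
     (\<forall>x\<in>S. \<forall>y\<in>S. \<forall>t. x \<noteq> y \<and> 0 < t \<and> t < 1 \<longrightarrow>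
        F ((1 - t) *\<^sub>R x + t *\<^sub>R y) < (1 - t) * F x + t * F y)"

text \<open>Meaningful only where the function is differentiable; gradients are then unique.\<close>

definition gradient :: "('b::real_inner \<Rightarrow> real) \<Rightarrow> 'b \<Rightarrow> 'b" where
  "gradient F x = (THE D. GDERIV F x :> D)"

text \<open>
  Agents, controllers and the labels of inequality and equality constraints are drawn from finite
  types \<open>'a\<close>, \<open>'k\<close>, \<open>'l\<close>, \<open>'m\<close>. The constraints owned by agent \<open>i\<close> are those with labels in
  \<open>Cin i\<close> and \<open>Ceq i\<close>, which may be empty and may differ in size from agent to agent.
\<close>

definition feasible ::
  "('a \<Rightarrow> 'l \<Rightarrow> real^'n \<Rightarrow> real) \<Rightarrow> ('a \<Rightarrow> 'm \<Rightarrow> real^'n \<Rightarrow> real) \<Rightarrow>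
   ('a \<Rightarrow> 'l set) \<Rightarrow> ('a \<Rightarrow> 'm set) \<Rightarrow> real^'n \<Rightarrow> bool" where
  "feasible g h Cin Ceq y \<longleftrightarrow>
     (\<forall>i. \<forall>l\<in>Cin i. g i l y \<le> 0) \<and> (\<forall>i. \<forall>j\<in>Ceq i. h i j y = 0)"

definition slater ::
  "('a \<Rightarrow> 'l \<Rightarrow> real^'n \<Rightarrow> real) \<Rightarrow> ('a \<Rightarrow> 'm \<Rightarrow> real^'n \<Rightarrow> real) \<Rightarrow>
   ('a \<Rightarrow> 'l set) \<Rightarrow> ('a \<Rightarrow> 'm set) \<Rightarrow> bool" where
  "slater g h Cin Ceq \<longleftrightarrow>
     (\<exists>y. (\<forall>i. \<forall>l\<in>Cin i. g i l y < 0) \<and> (\<forall>i. \<forall>j\<in>Ceq i. h i j y = 0))"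

definition lagrangian ::
  "('a \<Rightarrow> real^'n \<Rightarrow> real) \<Rightarrow> ('a \<Rightarrow> 'l \<Rightarrow> real^'n \<Rightarrow> real) \<Rightarrow> ('a \<Rightarrow> 'm \<Rightarrow> real^'n \<Rightarrow> real) \<Rightarrow>
   ('a \<Rightarrow> 'l set) \<Rightarrow> ('a \<Rightarrow> 'm set) \<Rightarrow> 'a \<Rightarrow> real^'n \<Rightarrow> real^'l \<Rightarrow> real^'m \<Rightarrow> real" where
  "lagrangian f g h Cin Ceq i x lam mu =
     f i x + (\<Sum>l\<in>Cin i. lam $ l * g i l x) + (\<Sum>j\<in>Ceq i. mu $ j * h i j x)"

subsection \<open>Stacked vectors and Kronecker products\<close>

definition kron :: "real^'q^'p \<Rightarrow> real^'s^'r \<Rightarrow> real^('q \<times> 's)^('p \<times> 'r)" where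
  "kron A B = (\<chi> r c. A $ fst r $ fst c * B $ snd r $ snd c)"

definition stack :: "real^'n^'p \<Rightarrow> real^('p \<times> 'n)" where
  "stack v = (\<chi> r. v $ fst r $ snd r)"

definition unstack :: "real^('p \<times> 'n) \<Rightarrow> real^'n^'p" where
  "unstack w = (\<chi> p. \<chi> c. w $ (p, c))"

subsection \<open>Dynamical systems\<close>

definition abs_continuous_on :: "real set \<Rightarrow> (real \<Rightarrow> 'b::real_normed_vector) \<Rightarrow> bool" where
  "abs_continuous_on I s \<longleftrightarrow>
     (\<forall>\<epsilon>>0. \<exists>\<delta>>0. \<forall>P :: (real \<times> real) set.
        finite P \<and> (\<forall>(u, v)\<in>P. u \<le> v \<and> {u..v} \<subseteq> I) \<and>
        pairwise (\<lambda>(u, v) (u', v'). {u<..<v} \<inter> {u'<..<v'} = {}) P \<and>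
        (\<Sum>(u, v)\<in>P. v - u) < \<delta> \<longrightarrow>
        (\<Sum>(u, v)\<in>P. norm (s v - s u)) < \<epsilon>)"

definition caratheodory_solution ::
  "('b::real_normed_vector \<Rightarrow> 'b) \<Rightarrow> 'b set \<Rightarrow> (real \<Rightarrow> 'b) \<Rightarrow> bool" where
  "caratheodory_solution F S s \<longleftrightarrow>
     (\<forall>t\<ge>0. s t \<in> S) \<and>
     (\<forall>T>0. abs_continuous_on {0..T} s) \<and>
     (AE t in lborel. 0 < t \<longrightarrow> (s has_vector_derivative F (s t)) (at t))"

definition equilibrium ::
  "('b::real_normed_vector \<Rightarrow> 'b) \<Rightarrow> 'b set \<Rightarrow> 'b \<Rightarrow> bool" where
  "equilibrium F S e \<longleftrightarrow> e \<in> S \<and> F e = 0"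

definition lyapunov_stable ::
  "('b::real_normed_vector \<Rightarrow> 'b) \<Rightarrow> 'b set \<Rightarrow> 'b \<Rightarrow> bool" where
  "lyapunov_stable F S e \<longleftrightarrow>
     (\<forall>\<epsilon>>0. \<exists>\<delta>>0. \<forall>s. caratheodory_solution F S s \<and> dist (s 0) e < \<delta> \<longrightarrow>
        (\<forall>t\<ge>0. dist (s t) e < \<epsilon>))"

text \<open>
  Stability of an output value: equilibrium states need not be unique, but all of them produce the
  output \<open>v\<close>. The first conjunct makes \<open>v\<close> an equilibrium output.
\<close>

definition output_globally_asymptotically_stable ::
  "('b::real_normed_vector \<Rightarrow> 'b) \<Rightarrow> 'b set \<Rightarrow> ('b \<Rightarrow> 'c::topological_space) \<Rightarrow> 'c \<Rightarrow> bool" where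
  "output_globally_asymptotically_stable F S out v \<longleftrightarrow>
     (\<exists>e. equilibrium F S e) \<and>
     (\<forall>e. equilibrium F S e \<longrightarrow> out e = v \<and> lyapunov_stable F S e) \<and>
     (\<forall>s. caratheodory_solution F S s \<longrightarrow> ((\<lambda>t. out (s t)) \<longlongrightarrow> v) at_top)"

subsection \<open>The closed loop\<close>

text \<open>The components are \<open>(x, \<lambda>, \<mu>, z)\<close>; the norm on the product is the Euclidean one.\<close>

type_synonym ('n, 'a, 'l, 'm, 'k) state =
  "(real^'n^'a) \<times> (real^'l^'a) \<times> (real^'m^'a) \<times> (real^'n^'k)"

text \<open>
  The multiplier dynamics only make sense on \<open>\<lambda> \<ge> 0\<close>, and so solutions are required to evolve there.
  An almost-everywhere solution that is allowed to leave this set can ignore the switching rule: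
  if \<open>g < 0\<close>, it may slip from \<open>\<lambda> = 0\<close> to negative values along \<open>\<lambda>' = g\<close>, because \<open>\<lambda> = 0\<close> then
  holds at a single instant only. Multiplier components whose label is not owned by the agent are
  not part of the system and are pinned to zero.
\<close>

definition state_space ::
  "('a \<Rightarrow> 'l set) \<Rightarrow> ('a \<Rightarrow> 'm set) \<Rightarrow>
   ('n::finite, 'a::finite, 'l::finite, 'm::finite, 'k::finite) state set" where
  "state_space Cin Ceq = {(x, lam, mu, z).
     (\<forall>i. \<forall>l\<in>Cin i. 0 \<le> lam $ i $ l) \<and>
     (\<forall>i l. l \<notin> Cin i \<longrightarrow> lam $ i $ l = 0) \<and>
     (\<forall>i j. j \<notin> Ceq i \<longrightarrow> mu $ i $ j = 0)}"

definition closed_loop ::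
  "('a \<Rightarrow> real^'n \<Rightarrow> real) \<Rightarrow> ('a \<Rightarrow> 'l \<Rightarrow> real^'n \<Rightarrow> real) \<Rightarrow> ('a \<Rightarrow> 'm \<Rightarrow> real^'n \<Rightarrow> real) \<Rightarrow>
   ('a \<Rightarrow> 'l set) \<Rightarrow> ('a \<Rightarrow> 'm set) \<Rightarrow> ('a \<Rightarrow> real) \<Rightarrow> ('k \<Rightarrow> real) \<Rightarrow> real^'k^'a \<Rightarrow>
   ('n::finite, 'a::finite, 'l::finite, 'm::finite, 'k::finite) state \<Rightarrow>
   ('n, 'a, 'l, 'm, 'k) state" where
  "closed_loop f g h Cin Ceq \<alpha> \<beta> E = (\<lambda>(x, lam, mu, z).
     let y = x;
         \<zeta> = unstack (transpose (kron E (mat 1 :: real^'n^'n)) *v stack y);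
         d = (\<chi> k. z $ k + \<beta> k *\<^sub>R \<zeta> $ k);
         u = unstack (- (kron E (mat 1 :: real^'n^'n) *v stack d))
     in (\<chi> i. - \<alpha> i *\<^sub>R gradient (\<lambda>\<xi>. lagrangian f g h Cin Ceq i \<xi> (lam $ i) (mu $ i)) (x $ i)
              + \<alpha> i *\<^sub>R u $ i,
         \<chi> i. \<chi> l. if l \<notin> Cin i \<or> lam $ i $ l = 0 \<and> g i l (x $ i) < 0 then 0 else g i l (x $ i),
         \<chi> i. \<chi> j. if j \<in> Ceq i then h i j (x $ i) else 0,
         \<chi> k. \<beta> k *\<^sub>R \<zeta> $ k))"

text \<open>The outputs are \<open>y\<^sub>i = x\<^sub>i\<close>.\<close>

definition agent_outputs ::
  "('n::finite, 'a::finite, 'l::finite, 'm::finite, 'k::finite) state \<Rightarrow> real^'n^'a" where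
  "agent_outputs = fst"

end

theory Submission
  imports Defs
begin

text \<open>
  Let \<open>e = (1 \<otimes> ystar, \<lambda>, \<mu>, z)\<close> be an equilibrium. The \<open>\<alpha>\<close>- and \<open>\<beta>\<close>-weighted squared
  distance to \<open>e\<close> is a Lyapunov function: since the Lagrangian is convex in \<open>x\<close> and affine in the
  multipliers, and the switching of the multipliers only helps, it decays at least at twice the rate
  \<open>W(x) = \<Sum>\<^sub>i (L\<^sub>i(x\<^sub>i, \<lambda>\<^sub>i, \<mu>\<^sub>i) - f\<^sub>i(ystar)) + \<langle>\<zeta>, z\<rangle> + \<Sum>\<^sub>k \<beta>\<^sub>k |\<zeta>\<^sub>k|\<^sup>2\<close> with \<open>\<zeta> = (E \<otimes> I)\<^sup>T x\<close>. This
  rate is continuous, depends on the output only, and vanishes only at consensus on \<open>ystar\<close>: the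
  last term forces consensus, on which \<open>W\<close> is strictly convex with minimizer \<open>ystar\<close>. Hence no
  invariance principle for the discontinuous closed loop is needed: the output is Lipschitz in time
  because the gradients are bounded, so every excursion away from \<open>ystar\<close> costs a fixed amount of
  energy. Equilibria exist by Slater's condition, because \<open>range E\<close> is the orthogonal complement of
  \<open>ker E\<^sup>T\<close>.
\<close>

subsection \<open>Absolutely continuous functions\<close>

text \<open>The Lipschitz bound is asked for only between points of the trajectory. This admits
  quadratic \<open>Q\<close>, which are Lipschitz on bounded sets only.\<close>

lemma abs_continuous_on_compose:
  fixes s :: "real \<Rightarrow> 'b::real_normed_vector" and Q :: "'b \<Rightarrow> 'c::real_normed_vector"
  assumes s: "abs_continuous_on I s"
    and Q: "\<And>t t'. t \<in> I \<Longrightarrow> t' \<in> I \<Longrightarrow> norm (Q (s t) - Q (s t')) \<le> C * norm (s t - s t')"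
  shows "abs_continuous_on I (\<lambda>t. Q (s t))"
  unfolding abs_continuous_on_def
proof (intro allI impI)
  fix \<epsilon> :: real assume "0 < \<epsilon>"
  \<comment> \<open>\<open>C\<close> may be zero or negative; \<open>C'\<close> is a positive
    constant for which the bound still holds.\<close>
  define C' where "C' = \<bar>C\<bar> + 1"
  have C': "C' > 0" by (simp add: C'_def add_nonneg_pos)
  obtain \<delta> where "\<delta> > 0" and \<delta>: "\<And>P :: (real \<times> real) set.
        finite P \<and> (\<forall>(u, v)\<in>P. u \<le> v \<and> {u..v} \<subseteq> I) \<and>
        pairwise (\<lambda>(u, v) (u', v'). {u<..<v} \<inter> {u'<..<v'} = {}) P \<and>
        (\<Sum>(u, v)\<in>P. v - u) < \<delta> \<Longrightarrow>
        (\<Sum>(u, v)\<in>P. norm (s v - s u)) < \<epsilon> / C'"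
    using s[unfolded abs_continuous_on_def, rule_format, OF divide_pos_pos[OF \<open>0 < \<epsilon>\<close> C']] by blast
  show "\<exists>\<delta>>0. \<forall>P :: (real \<times> real) set. finite P \<and> (\<forall>(u, v)\<in>P. u \<le> v \<and> {u..v} \<subseteq> I) \<and>
        pairwise (\<lambda>(u, v) (u', v'). {u<..<v} \<inter> {u'<..<v'} = {}) P \<and>
        (\<Sum>(u, v)\<in>P. v - u) < \<delta> \<longrightarrow>
        (\<Sum>(u, v)\<in>P. norm (Q (s v) - Q (s u))) < \<epsilon>"
  proof (intro exI conjI allI impI)
    fix P :: "(real \<times> real) set"
    assume P: "finite P \<and> (\<forall>(u, v)\<in>P. u \<le> v \<and> {u..v} \<subseteq> I) \<and>
        pairwise (\<lambda>(u, v) (u', v'). {u<..<v} \<inter> {u'<..<v'} = {}) P \<and>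
        (\<Sum>(u, v)\<in>P. v - u) < \<delta>"
    have "(\<Sum>(u, v)\<in>P. norm (Q (s v) - Q (s u))) \<le> (\<Sum>(u, v)\<in>P. C' * norm (s v - s u))"
    proof (rule sum_mono, clarify)
      fix u v assume "(u, v) \<in> P"
      then have "u \<in> I" "v \<in> I" using P by (auto simp: subset_iff)
      then have "norm (Q (s v) - Q (s u)) \<le> C * norm (s v - s u)" by (rule Q[rotated])
      also have "\<dots> \<le> C' * norm (s v - s u)"
        by (rule mult_right_mono) (auto simp: C'_def)
      finally show "norm (Q (s v) - Q (s u)) \<le> C' * norm (s v - s u)" .
    qed
    also have "\<dots> = C' * (\<Sum>(u, v)\<in>P. norm (s v - s u))"
      by (simp add: sum_distrib_left case_prod_unfold)
    also have "\<dots> < \<epsilon>"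
      using \<delta>[OF P] C' by (simp add: field_simps)
    finally show "(\<Sum>(u, v)\<in>P. norm (Q (s v) - Q (s u))) < \<epsilon>" .
  qed (fact \<open>\<delta> > 0\<close>)
qed

lemma abs_continuous_on_subset:
  "abs_continuous_on I s \<Longrightarrow> J \<subseteq> I \<Longrightarrow> abs_continuous_on J s"
  unfolding abs_continuous_on_def
proof (intro allI impI)
  fix \<epsilon> :: real
  assume s: "\<forall>\<epsilon>>0. \<exists>\<delta>>0. \<forall>P :: (real \<times> real) set. finite P \<and> (\<forall>(u, v)\<in>P. u \<le> v \<and> {u..v} \<subseteq> I) \<and>
        pairwise (\<lambda>(u, v) (u', v'). {u<..<v} \<inter> {u'<..<v'} = {}) P \<and>
        (\<Sum>(u, v)\<in>P. v - u) < \<delta> \<longrightarrow> (\<Sum>(u, v)\<in>P. norm (s v - s u)) < \<epsilon>"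
    and J: "J \<subseteq> I" and "0 < \<epsilon>"
  obtain \<delta> where "\<delta> > 0" and \<delta>: "\<And>P :: (real \<times> real) set.
        finite P \<and> (\<forall>(u, v)\<in>P. u \<le> v \<and> {u..v} \<subseteq> I) \<and>
        pairwise (\<lambda>(u, v) (u', v'). {u<..<v} \<inter> {u'<..<v'} = {}) P \<and>
        (\<Sum>(u, v)\<in>P. v - u) < \<delta> \<Longrightarrow> (\<Sum>(u, v)\<in>P. norm (s v - s u)) < \<epsilon>"
    using s[rule_format, OF \<open>0 < \<epsilon>\<close>] by blast
  show "\<exists>\<delta>>0. \<forall>P :: (real \<times> real) set. finite P \<and> (\<forall>(u, v)\<in>P. u \<le> v \<and> {u..v} \<subseteq> J) \<and>
        pairwise (\<lambda>(u, v) (u', v'). {u<..<v} \<inter> {u'<..<v'} = {}) P \<and>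
        (\<Sum>(u, v)\<in>P. v - u) < \<delta> \<longrightarrow> (\<Sum>(u, v)\<in>P. norm (s v - s u)) < \<epsilon>"
  proof (intro exI conjI allI impI)
    fix P :: "(real \<times> real) set"
    assume P: "finite P \<and> (\<forall>(u, v)\<in>P. u \<le> v \<and> {u..v} \<subseteq> J) \<and>
        pairwise (\<lambda>(u, v) (u', v'). {u<..<v} \<inter> {u'<..<v'} = {}) P \<and> (\<Sum>(u, v)\<in>P. v - u) < \<delta>"
    moreover have "\<forall>(u, v)\<in>P. u \<le> v \<and> {u..v} \<subseteq> I" using P J by fast
    ultimately show "(\<Sum>(u, v)\<in>P. norm (s v - s u)) < \<epsilon>" by (intro \<delta>) simp
  qed (fact \<open>\<delta> > 0\<close>)
qed

text \<open>Tags in the exceptional null set are controlled by absolute continuity, all others by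
  the derivative, on one tagged division that is fine for both.\<close>

lemma abs_continuous_on_increment_le:
  fixes \<phi> :: "real \<Rightarrow> real"
  assumes ac: "abs_continuous_on {a..b} \<phi>" and ab: "a \<le> b"
    and deriv: "AE t in lborel. a < t \<and> t < b \<longrightarrow> (\<exists>D. (\<phi> has_vector_derivative D) (at t) \<and> D \<le> M)"
  shows "\<phi> b - \<phi> a \<le> M * (b - a)"
proof -
  \<comment> \<open>The slack splits into \<open>e * (b - a)\<close>, the derivative error at good
    tags, and \<open>2 * e\<close> for all cells with bad tags together.\<close>
  have main: "\<phi> b - \<phi> a \<le> M * (b - a) + e * (b - a + 2)" if e: "0 < e" "e \<le> 1" for e
  proof -
    \<comment> \<open>The bad tags. Both endpoints are among them, since the derivative is
      controlled on the open interval only.\<close>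
    define B where "B = {t. \<not> (a < t \<and> t < b \<and> (\<exists>D. (\<phi> has_vector_derivative D) (at t) \<and> D \<le> M))}"
    obtain N :: "real set" where N: "N \<in> null_sets lborel"
      "{t. \<not> (a < t \<and> t < b \<longrightarrow> (\<exists>D. (\<phi> has_vector_derivative D) (at t) \<and> D \<le> M))} \<subseteq> N"
      using deriv by (rule eventually_ae_filter[THEN iffD1, THEN bexE]) simp
    have "negligible N" using N(1) by (simp add: negligible_iff_null_sets null_sets_completionI)
    then have neg: "negligible (N \<union> {a, b})" by simp
    have BN: "B \<inter> {a..b} \<subseteq> N \<union> {a, b}" using N(2) by (force simp: B_def subset_iff less_le)
    obtain \<delta>0 where "\<delta>0 > 0" and \<delta>0: "\<And>P :: (real \<times> real) set.
        finite P \<and> (\<forall>(u, v)\<in>P. u \<le> v \<and> {u..v} \<subseteq> {a..b}) \<and>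
        pairwise (\<lambda>(u, v) (u', v'). {u<..<v} \<inter> {u'<..<v'} = {}) P \<and>
        (\<Sum>(u, v)\<in>P. v - u) < \<delta>0 \<Longrightarrow>
        (\<Sum>(u, v)\<in>P. norm (\<phi> v - \<phi> u)) < e"
      using ac[unfolded abs_continuous_on_def, rule_format, OF e(1)] by blast
    \<comment> \<open>Two demands on the total length of the bad cells: below
      \<open>\<delta>0\<close> the variation of \<open>\<phi>\<close> over them is less than
      \<open>e\<close>, and below \<open>e / (\<bar>M\<bar> + 1)\<close> the correction term in
      \<open>R\<close> stays below \<open>e\<close>.\<close>
    define \<delta> where "\<delta> = min \<delta>0 (e / (\<bar>M\<bar> + 1))"
    have \<delta>: "\<delta> > 0" "\<delta> \<le> \<delta>0" "(\<bar>M\<bar> + 1) * \<delta> \<le> e"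
    proof -
      show "\<delta> > 0" "\<delta> \<le> \<delta>0" using \<open>\<delta>0 > 0\<close> e by (auto simp: \<delta>_def)
      have "\<delta> \<le> e / (\<bar>M\<bar> + 1)" by (simp add: \<delta>_def)
      then show "(\<bar>M\<bar> + 1) * \<delta> \<le> e" by (simp add: pos_le_divide_eq mult.commute)
    qed
    \<comment> \<open>Outer regularity: the null set that contains the bad tags of
      \<open>{a..b}\<close> lies in an open set of measure below \<open>\<delta>\<close>.\<close>
    obtain U where U: "open U" "N \<union> {a, b} \<subseteq> U" "U \<in> lmeasurable" "measure lebesgue U < \<delta>"
    proof -
      have "N \<union> {a, b} \<in> sets lebesgue" using neg negligible_imp_sets by blast
      then obtain T where T: "open T" "N \<union> {a, b} \<subseteq> T" "T - (N \<union> {a, b}) \<in> lmeasurable"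
        "emeasure lebesgue (T - (N \<union> {a, b})) < ennreal \<delta>"
        using sets_lebesgue_outer_open \<delta>(1) by blast
      have eq: "T = (T - (N \<union> {a, b})) \<union> (N \<union> {a, b})" using T(2) by auto
      have "T \<in> lmeasurable"
        by (subst eq, intro fmeasurable.Un T(3) negligible_imp_measurable neg)
      moreover have "measure lebesgue T = measure lebesgue (T - (N \<union> {a, b}))"
        by (metis eq T(3) fmeasurableD measure_Un_null_set neg negligible_iff_null_sets)
      moreover have "measure lebesgue (T - (N \<union> {a, b})) < \<delta>"
        using T(3,4) \<delta>(1) by (simp add: emeasure_eq_measure2 ennreal_less_iff)
      ultimately show ?thesis using that T by auto
    qed
    \<comment> \<open>The gauge treats the two kinds of tags differently. At a bad tag the ball
      stays inside \<open>U\<close>. At a good tag the straddle form of differentiability is used: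
      for \<open>u \<le> x \<le> v\<close> the errors on both sides of the tag add up to a multiple
      of \<open>v - u\<close>.\<close>
    have "\<exists>r>0. (x \<in> B \<longrightarrow> x \<in> {a..b} \<longrightarrow> ball x r \<subseteq> U) \<and>
        (x \<notin> B \<longrightarrow> (\<forall>u v. u \<le> x \<and> x \<le> v \<and> u \<in> ball x r \<and> v \<in> ball x r \<longrightarrow>
            \<phi> v - \<phi> u \<le> (M + e) * (v - u)))" for x
    proof (cases "x \<in> B")
      case True
      then show ?thesis using U(1,2) BN
        by (metis Int_iff openE subsetD zero_less_one)
    next
      case False
      then obtain D where D: "(\<phi> has_vector_derivative D) (at x)" "D \<le> M"
        by (auto simp: B_def)
      obtain r where "r > 0" and
        r: "\<And>y. norm (y - x) < r \<Longrightarrow> norm (\<phi> y - \<phi> x - (y - x) *\<^sub>R D) \<le> e * norm (y - x)"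
        using D(1) e(1) unfolding has_vector_derivative_def has_derivative_at_alt by blast
      have "\<phi> v - \<phi> u \<le> (M + e) * (v - u)"
        if "u \<le> x" "x \<le> v" "u \<in> ball x r" "v \<in> ball x r" for u v
      proof -
        have "\<phi> v - \<phi> x - (v - x) * D \<le> e * (v - x)"
          using r[of v] that by (auto simp: dist_norm abs_minus_commute)
        moreover have "\<phi> x - \<phi> u - (x - u) * D \<le> e * (x - u)"
        proof -
          have "\<bar>\<phi> u - \<phi> x - (u - x) * D\<bar> \<le> e * \<bar>u - x\<bar>"
            using r[of u] that by (auto simp: dist_norm abs_minus_commute)
          then show ?thesis using that(1) by (simp add: algebra_simps abs_le_iff)
        qed
        ultimately have "\<phi> v - \<phi> u \<le> (D + e) * (v - u)" by (simp add: algebra_simps)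
        also have "\<dots> \<le> (M + e) * (v - u)"
          using that D(2) by (intro mult_right_mono) auto
        finally show ?thesis .
      qed
      then show ?thesis using \<open>r > 0\<close> False by blast
    qed
    then obtain r where r: "\<And>x. r x > 0"
      "\<And>x. x \<in> B \<Longrightarrow> x \<in> {a..b} \<Longrightarrow> ball x (r x) \<subseteq> U"
      "\<And>x u v. x \<notin> B \<Longrightarrow> u \<le> x \<Longrightarrow> x \<le> v \<Longrightarrow> u \<in> ball x (r x) \<Longrightarrow> v \<in> ball x (r x) \<Longrightarrow>
            \<phi> v - \<phi> u \<le> (M + e) * (v - u)"
      by metis
    have "gauge (\<lambda>x. ball x (r x))" using r(1) by (rule gauge_ball_dependent[rule_format])
    then obtain p where p: "p tagged_division_of {a..b}" "(\<lambda>x. ball x (r x)) fine p"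
      by (rule fine_division_exists_real)
    note pD = tagged_division_ofD[OF p(1)]
    \<comment> \<open>The bad cells. Degenerate cells have zero increment and are left out, so that
      disjointness of interiors makes \<open>iv\<close> injective on \<open>q\<close>.\<close>
    define q where "q = {(x, K) \<in> p. x \<in> B \<and> Inf K < Sup K}"
    have q: "finite q" "q \<subseteq> p" using pD(1) by (auto simp: q_def intro: finite_subset)
    have K: "K = {Inf K..Sup K} \<and> Inf K \<le> x \<and> x \<le> Sup K \<and> K \<subseteq> {a..b} \<and> K \<subseteq> ball x (r x)
        \<and> {Inf K..Sup K} \<subseteq> {a..b} \<and> Inf K \<in> K \<and> Sup K \<in> K"
      if "(x, K) \<in> p" for x K
    proof -
      obtain u v where "K = cbox u v" using pD(4)[OF \<open>(x, K) \<in> p\<close>] by blast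
      moreover have "x \<in> K" using pD(2)[OF that] .
      ultimately show ?thesis using pD(3)[OF that] p(2) that by (auto simp: fine_def)
    qed
    define iv where "iv = (\<lambda>(x :: real, K :: real set). (Inf K, Sup K))"
    have disj: "{Inf K<..<Sup K} \<inter> {Inf K'<..<Sup K'} = {}"
      if "(x, K) \<in> p" "(x', K') \<in> p" "(x, K) \<noteq> (x', K')" for x K x' K'
      using pD(5)[OF that] K[OF that(1)] K[OF that(2)] by (metis interior_atLeastAtMost_real)
    have inj: "inj_on iv q"
    proof (rule inj_onI, clarify)
      fix x K x' K' assume *: "(x, K) \<in> q" "(x', K') \<in> q" "iv (x, K) = iv (x', K')"
      show "x = x' \<and> K = K'"
      proof (rule ccontr)
        assume "\<not> (x = x' \<and> K = K')"
        then have "{Inf K<..<Sup K} \<inter> {Inf K'<..<Sup K'} = {}"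
          using * q(2) by (intro disj) auto
        then show False using * by (auto simp: iv_def q_def)
      qed
    qed
    have sumq: "(\<Sum>(x, K)\<in>q. F (Inf K) (Sup K)) = (\<Sum>(u, v)\<in>iv ` q. F u v)"
      for F :: "real \<Rightarrow> real \<Rightarrow> real"
      by (subst sum.reindex[OF inj]) (simp add: iv_def case_prod_unfold)
    \<comment> \<open>The interiors of the bad cells are disjoint subsets of \<open>U\<close>, so
      their total length is at most the measure of \<open>U\<close>.\<close>
    have len: "(\<Sum>(x, K)\<in>q. Sup K - Inf K) < \<delta>"
    proof -
      have "(\<Sum>(x, K)\<in>q. Sup K - Inf K) = (\<Sum>i\<in>q. measure lebesgue {Inf (snd i)<..<Sup (snd i)})"
        by (rule sum.cong) (auto simp: q_def)
      also have "\<dots> = measure lebesgue (\<Union>i\<in>q. {Inf (snd i)<..<Sup (snd i)})"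
      proof (rule measure_UNION'[symmetric])
        show "pairwise (\<lambda>i j. disjnt {Inf (snd i)<..<Sup (snd i)} {Inf (snd j)<..<Sup (snd j)}) q"
          unfolding pairwise_def disjnt_def using disj q(2)
          by (metis prod.collapse subsetD)
      qed (use q in \<open>auto intro: bounded_set_imp_lmeasurable\<close>)
      also have "\<dots> \<le> measure lebesgue U"
      proof (rule measure_mono_fmeasurable[OF _ _ U(3)])
        show "(\<Union>i\<in>q. {Inf (snd i)<..<Sup (snd i)}) \<subseteq> U"
        proof clarsimp
          fix x K t assume "(x, K) \<in> q" "Inf K < t" "t < Sup K"
          moreover from this have "t \<in> K" using K[of x K] q(2)
            by (metis atLeastAtMost_iff less_imp_le subsetD)
          moreover have "x \<in> B" "(x, K) \<in> p" using \<open>(x, K) \<in> q\<close> by (auto simp: q_def)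
          moreover from this have "x \<in> {a..b}" using K[of x K] pD(2)[of x K] by blast
          ultimately show "t \<in> U" using r(2)[of x] K[of x K] by blast
        qed
      qed (use q in auto)
      finally show ?thesis using U(4) by simp
    qed
    have var: "(\<Sum>(x, K)\<in>q. \<bar>\<phi> (Sup K) - \<phi> (Inf K)\<bar>) < e"
    proof -
      have "(\<Sum>(u, v)\<in>iv ` q. norm (\<phi> v - \<phi> u)) < e"
      proof (rule \<delta>0, intro conjI)
        show "\<forall>(u, v)\<in>iv ` q. u \<le> v \<and> {u..v} \<subseteq> {a..b}"
        proof (rule ballI)
          fix w assume "w \<in> iv ` q"
          then obtain x K where xK: "(x, K) \<in> p" "w = (Inf K, Sup K)"
            using q(2) by (auto simp: iv_def)
          show "case w of (u, v) \<Rightarrow> u \<le> v \<and> {u..v} \<subseteq> {a..b}"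
            unfolding xK(2) prod.case using K[OF xK(1)] by linarith
        qed
        show "pairwise (\<lambda>(u, v) (u', v'). {u<..<v} \<inter> {u'<..<v'} = {}) (iv ` q)"
        proof -
          have dj: "{Inf (snd i)<..<Sup (snd i)} \<inter> {Inf (snd j)<..<Sup (snd j)} = {}"
            if "i \<in> q" "j \<in> q" "i \<noteq> j" for i j
            using that q(2) by (intro disj[of "fst i" "snd i" "fst j" "snd j"]) auto
          show ?thesis
            unfolding pairwise_def iv_def case_prod_unfold
            by (intro ballI impI, elim imageE, simp only: fst_conv snd_conv, rule dj) auto
        qed
        show "(\<Sum>(u, v)\<in>iv ` q. v - u) < \<delta>0"
          using len sumq[of "\<lambda>u v. v - u"] \<delta>(2) by simp
      qed (use q in auto)
      then show ?thesis using sumq[of "\<lambda>u v. \<bar>\<phi> v - \<phi> u\<bar>"] by simp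
    qed
    \<comment> \<open>\<open>M\<close> may be negative. On a bad cell the summand
      \<open>(\<bar>M\<bar> + 1) * (Sup K - Inf K)\<close> keeps
      \<open>(M + e) * (Sup K - Inf K)\<close> plus it nonnegative, so one bound covers good and bad
      cells.\<close>
    define R where "R = (\<lambda>(x :: real, K). \<bar>\<phi> (Sup K) - \<phi> (Inf K)\<bar> + (\<bar>M\<bar> + 1) * (Sup K - Inf K))"
    have step: "\<phi> (Sup K) - \<phi> (Inf K) \<le> (M + e) * (Sup K - Inf K) + (if (x, K) \<in> q then R (x, K) else 0)"
      if "(x, K) \<in> p" for x K
    proof (cases "(x, K) \<in> q")
      case True
      have "0 \<le> (M + e + (\<bar>M\<bar> + 1)) * (Sup K - Inf K)"
        using K[OF that] e by (intro mult_nonneg_nonneg) auto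
      then show ?thesis using True by (simp add: R_def algebra_simps)
    next
      case False
      note Kp = K[OF that]
      show ?thesis
      proof (cases "Inf K = Sup K")
        case True
        then show ?thesis using False by simp
      next
        case ne: False
        then have "x \<notin> B" using False that Kp by (auto simp: q_def)
        moreover have "Inf K \<in> K" "Sup K \<in> K" using Kp by blast+
        ultimately have "\<phi> (Sup K) - \<phi> (Inf K) \<le> (M + e) * (Sup K - Inf K)"
          using Kp by (intro r(3)[of x]) auto
        then show ?thesis using False by simp
      qed
    qed
    have "\<phi> b - \<phi> a = (\<Sum>(x, K)\<in>p. \<phi> (Sup K) - \<phi> (Inf K))"
      using additive_tagged_division_1[OF ab p(1), of \<phi>] by simp
    also have "\<dots> \<le> (\<Sum>(x, K)\<in>p. (M + e) * (Sup K - Inf K) + (if (x, K) \<in> q then R (x, K) else 0))"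
      using step by (intro sum_mono) auto
    also have "\<dots> = (M + e) * (\<Sum>(x, K)\<in>p. Sup K - Inf K) + (\<Sum>i\<in>p. if i \<in> q then R i else 0)"
      by (simp add: case_prod_unfold sum.distrib sum_distrib_left cong: if_cong)
    also have "(\<Sum>(x, K)\<in>p. Sup K - Inf K) = b - a"
      using additive_tagged_division_1[OF ab p(1), of "\<lambda>x. x"] by simp
    also have "(\<Sum>i\<in>p. if i \<in> q then R i else 0) = (\<Sum>i\<in>q. R i)"
      using sum.inter_restrict[OF pD(1), of R q] q(2) by (simp add: Int_absorb1)
    also have "(\<Sum>i\<in>q. R i) = (\<Sum>(x, K)\<in>q. \<bar>\<phi> (Sup K) - \<phi> (Inf K)\<bar>)
        + (\<bar>M\<bar> + 1) * (\<Sum>(x, K)\<in>q. Sup K - Inf K)"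
      by (simp add: R_def case_prod_unfold sum.distrib sum_distrib_left)
    also have "\<dots> \<le> e + (\<bar>M\<bar> + 1) * \<delta>"
      using var len by (intro add_mono mult_left_mono) auto
    also have "\<dots> \<le> 2 * e" using \<delta>(3) by simp
    finally show ?thesis by (simp add: algebra_simps)
  qed
  show ?thesis
  proof (rule field_le_epsilon)
    fix \<epsilon> :: real assume "0 < \<epsilon>"
    \<comment> \<open>Chosen so that the total slack of \<open>main\<close> is at most
      \<open>\<epsilon>\<close> while \<open>e \<le> 1\<close>.\<close>
    define e where "e = min 1 (\<epsilon> / (b - a + 2))"
    have "0 < e" "e \<le> 1" using \<open>0 < \<epsilon>\<close> ab by (auto simp: e_def)
    moreover have "e * (b - a + 2) \<le> \<epsilon>"
    proof -
      have "e \<le> \<epsilon> / (b - a + 2)" by (simp add: e_def)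
      then show ?thesis using ab by (simp add: pos_le_divide_eq)
    qed
    ultimately show "\<phi> b - \<phi> a \<le> M * (b - a) + \<epsilon>" using main[of e] by linarith
  qed
qed

lemma abs_continuous_on_imp_continuous_on:
  fixes s :: "real \<Rightarrow> 'b::real_normed_vector"
  assumes "abs_continuous_on {a..b} s"
  shows "continuous_on {a..b} s"
  unfolding continuous_on_iff
proof (intro ballI allI impI)
  fix x \<epsilon> :: real assume x: "x \<in> {a..b}" and "0 < \<epsilon>"
  obtain \<delta> where "\<delta> > 0" and \<delta>: "\<And>P :: (real \<times> real) set.
        finite P \<and> (\<forall>(u, v)\<in>P. u \<le> v \<and> {u..v} \<subseteq> {a..b}) \<and>
        pairwise (\<lambda>(u, v) (u', v'). {u<..<v} \<inter> {u'<..<v'} = {}) P \<and>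
        (\<Sum>(u, v)\<in>P. v - u) < \<delta> \<Longrightarrow> (\<Sum>(u, v)\<in>P. norm (s v - s u)) < \<epsilon>"
    using assms[unfolded abs_continuous_on_def, rule_format, OF \<open>0 < \<epsilon>\<close>] by blast
  show "\<exists>d>0. \<forall>x'\<in>{a..b}. dist x' x < d \<longrightarrow> dist (s x') (s x) < \<epsilon>"
  proof (intro exI conjI ballI impI)
    fix y assume y: "y \<in> {a..b}" "dist y x < \<delta>"
    have "(\<Sum>(u, v)\<in>{(min x y, max x y)}. norm (s v - s u)) < \<epsilon>"
      using x y by (intro \<delta>) (auto simp: dist_real_def)
    then show "dist (s y) (s x) < \<epsilon>"
      by (auto simp: dist_norm min_def max_def norm_minus_commute split: if_splits)
  qed (fact \<open>\<delta> > 0\<close>)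
qed

subsection \<open>Quadratic Lyapunov functions\<close>

text \<open>\<open>B\<close> is an inner product equivalent to the given one. Along a solution the
  derivative of \<open>B (s - e) (s - e)\<close> is \<open>2 * B (s - e) (F s)\<close>, so
  \<open>dissipation\<close> means decay at twice the rate \<open>W\<close>. As \<open>W\<close>
  sees only the output, the loss of energy can be read off from the output alone.\<close>

locale quadratic_lyapunov =
  fixes B :: "'b::euclidean_space \<Rightarrow> 'b \<Rightarrow> real" and \<kappa> :: real
    and F :: "'b \<Rightarrow> 'b" and S :: "'b set" and e :: 'b
    and out :: "'b \<Rightarrow> 'c::euclidean_space" and W :: "'c \<Rightarrow> real"
  assumes bilinear: "bounded_bilinear B"
    and sym: "B p q = B q p"
    and coercive: "0 < \<kappa>" "\<kappa> * (norm p)\<^sup>2 \<le> B p p"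
    and dissipation: "p \<in> S \<Longrightarrow> B (p - e) (F p) \<le> - W (out p)"
    and W_nonneg: "0 \<le> W y"
begin

interpretation B: bounded_bilinear B by (rule bilinear)

text \<open>On a compact time interval the trajectory is bounded, and on bounded sets a quadratic
  form is Lipschitz.\<close>

lemma abs_continuous_on_energy:
  assumes s: "abs_continuous_on {a..b} s"
  shows "abs_continuous_on {a..b} (\<lambda>t. B (s t - e) (s t - e))"
proof -
  obtain K where K: "K > 0" "\<And>p q. norm (B p q) \<le> norm p * norm q * K"
    using B.pos_bounded by blast
  have "compact (s ` {a..b})"
    by (intro compact_continuous_image abs_continuous_on_imp_continuous_on s) simp
  then have "bounded ((\<lambda>p. p - e) ` s ` {a..b})"
    by (intro bounded_translation_minus compact_imp_bounded)
  then obtain R where R: "\<And>t. t \<in> {a..b} \<Longrightarrow> norm (s t - e) \<le> R"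
    unfolding bounded_iff by (metis imageI)
  show ?thesis
  proof (rule abs_continuous_on_compose[OF s, of "\<lambda>p. B (p - e) (p - e)"])
    fix t t' assume t: "t \<in> {a..b}" "t' \<in> {a..b}"
    have "B (s t - e) (s t - e) - B (s t' - e) (s t' - e)
        = B (s t - s t') (s t - e) + B (s t' - e) (s t - s t')"
      by (simp add: B.diff_left B.diff_right)
    also have "norm \<dots> \<le> norm (s t - s t') * norm (s t - e) * K + norm (s t' - e) * norm (s t - s t') * K"
      by (intro norm_triangle_le add_mono K(2))
    also have "\<dots> = norm (s t - s t') * K * (norm (s t - e) + norm (s t' - e))"
      by (simp add: algebra_simps)
    also have "\<dots> \<le> norm (s t - s t') * K * (R + R)"
      using K(1) R[OF t(1)] R[OF t(2)] by (intro mult_left_mono add_mono) auto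
    finally show "norm (B (s t - e) (s t - e) - B (s t' - e) (s t' - e)) \<le> K * (R + R) * norm (s t - s t')"
      by (simp add: mult_ac)
  qed
qed

text \<open>The product rule and the symmetry of \<open>B\<close> bound the derivative almost
  everywhere, and absolute continuity integrates the bound. With \<open>m = 0\<close> this is
  monotonicity; with \<open>m > 0\<close> it measures the cost of an excursion of the
  output.\<close>

lemma energy_decrease:
  assumes s: "caratheodory_solution F S s" and t: "0 \<le> t0" "t0 \<le> t1"
    and m: "\<And>t. t0 < t \<Longrightarrow> t < t1 \<Longrightarrow> m \<le> W (out (s t))"
  shows "B (s t1 - e) (s t1 - e) - B (s t0 - e) (s t0 - e) \<le> - 2 * m * (t1 - t0)"
proof (rule abs_continuous_on_increment_le[OF _ t(2)])
  \<comment> \<open>\<open>t1 + 1\<close> instead of \<open>t1\<close>, because solutions are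
    absolutely continuous on \<open>{0..T}\<close> for \<open>T > 0\<close> and \<open>t1\<close>
    may be zero.\<close>
  have "abs_continuous_on {0..t1 + 1} s" using s t by (auto simp: caratheodory_solution_def)
  then show "abs_continuous_on {t0..t1} (\<lambda>t. B (s t - e) (s t - e))"
    using t by (intro abs_continuous_on_energy) (auto elim: abs_continuous_on_subset)
  have "AE t in lborel. 0 < t \<longrightarrow> (s has_vector_derivative F (s t)) (at t)"
    using s by (simp add: caratheodory_solution_def)
  then show "AE t in lborel. t0 < t \<and> t < t1 \<longrightarrow>
      (\<exists>D. ((\<lambda>t. B (s t - e) (s t - e)) has_vector_derivative D) (at t) \<and> D \<le> - 2 * m)"
  proof (eventually_elim, intro impI exI conjI)
    fix t assume *: "0 < t \<longrightarrow> (s has_vector_derivative F (s t)) (at t)" and tt: "t0 < t \<and> t < t1"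
    then have d: "((\<lambda>t. s t - e) has_vector_derivative F (s t)) (at t)"
      using t by (auto intro!: derivative_eq_intros)
    show "((\<lambda>t. B (s t - e) (s t - e)) has_vector_derivative
        (B (s t - e) (F (s t)) + B (F (s t)) (s t - e))) (at t)"
      by (rule B.has_vector_derivative[OF d d])
    have "s t \<in> S" using s tt t by (auto simp: caratheodory_solution_def)
    then show "B (s t - e) (F (s t)) + B (F (s t)) (s t - e) \<le> - 2 * m"
      using dissipation[of "s t"] m[of t] tt by (simp add: sym[of "F (s t)"])
  qed
qed

lemma energy_le:
  assumes "caratheodory_solution F S s" and "0 \<le> t"
  shows "B (s t - e) (s t - e) \<le> B (s 0 - e) (s 0 - e)"
  using energy_decrease[OF assms(1) order_refl assms(2), where m = 0] W_nonneg by simp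

lemma lyapunov_stable: "lyapunov_stable F S e"
  unfolding lyapunov_stable_def
proof (intro allI impI)
  fix \<epsilon> :: real assume "0 < \<epsilon>"
  obtain K where K: "K > 0" "\<And>p q. norm (B p q) \<le> norm p * norm q * K"
    using B.pos_bounded by blast
  show "\<exists>\<delta>>0. \<forall>s. caratheodory_solution F S s \<and> dist (s 0) e < \<delta> \<longrightarrow> (\<forall>t\<ge>0. dist (s t) e < \<epsilon>)"
  proof (intro exI conjI allI impI)
    \<comment> \<open>Since \<open>B p p\<close> lies between \<open>\<kappa>\<close> and
      \<open>K\<close> times the squared norm, this radius makes the initial energy less than
      \<open>\<kappa> * \<epsilon>\<^sup>2\<close>, a level that confines the state to the
      \<open>\<epsilon>\<close>-ball.\<close>
    show "\<epsilon> * sqrt (\<kappa> / K) > 0" using \<open>0 < \<epsilon>\<close> K(1) coercive(1) by simp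
    fix s and t :: real
    assume s: "caratheodory_solution F S s \<and> dist (s 0) e < \<epsilon> * sqrt (\<kappa> / K)" and t: "0 \<le> t"
    have "\<kappa> * (norm (s t - e))\<^sup>2 \<le> B (s 0 - e) (s 0 - e)"
      using coercive(2)[of "s t - e"] energy_le[of s t] s t by simp
    also have "\<dots> \<le> K * (norm (s 0 - e))\<^sup>2"
      using K(2)[of "s 0 - e" "s 0 - e"] by (simp add: power2_eq_square mult_ac)
    also have "\<dots> < K * (\<epsilon> * sqrt (\<kappa> / K))\<^sup>2"
      using s K(1) by (intro mult_strict_left_mono power_strict_mono) (auto simp: dist_norm)
    also have "\<dots> = \<kappa> * \<epsilon>\<^sup>2"
      using K(1) coercive(1) by (simp add: power_mult_distrib field_simps)
    finally have "(norm (s t - e))\<^sup>2 < \<epsilon>\<^sup>2" using coercive(1) by simp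
    then show "dist (s t) e < \<epsilon>"
      using \<open>0 < \<epsilon>\<close> by (auto simp: dist_norm intro: power_less_imp_less_base)
  qed
qed

section \<open>Boundedness of solutions and convergence of the output\<close>

lemma solution_bounded:
  assumes s: "caratheodory_solution F S s"
  obtains r where "\<And>t. 0 \<le> t \<Longrightarrow> norm (s t) \<le> r"
proof
  fix t :: real assume "0 \<le> t"
  have "(norm (s t - e))\<^sup>2 \<le> B (s 0 - e) (s 0 - e) / \<kappa>"
    using coercive(2)[of "s t - e"] coercive(1) energy_le[OF s \<open>0 \<le> t\<close>]
    by (simp add: pos_le_divide_eq mult.commute)
  then have "norm (s t - e) \<le> sqrt (B (s 0 - e) (s 0 - e) / \<kappa>)" by (rule real_le_rsqrt)
  then show "norm (s t) \<le> norm e + sqrt (B (s 0 - e) (s 0 - e) / \<kappa>)"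
    using norm_triangle_ineq[of "s t - e" e] by simp
qed

text \<open>Solutions are bounded, so the velocity of the output is bounded along them. The
  increment estimate is scalar; it is applied to the component of the output in the direction of its
  own increment.\<close>

lemma output_lipschitz:
  assumes out: "bounded_linear out"
    and bound: "\<And>r. \<exists>M. \<forall>p\<in>S. norm p \<le> r \<longrightarrow> norm (out (F p)) \<le> M"
    and s: "caratheodory_solution F S s"
  obtains M where "\<And>t t'. 0 \<le> t \<Longrightarrow> t \<le> t' \<Longrightarrow> norm (out (s t') - out (s t)) \<le> M * (t' - t)"
proof -
  interpret out: bounded_linear out by (rule out)
  obtain r where r: "\<And>t. 0 \<le> t \<Longrightarrow> norm (s t) \<le> r" using solution_bounded[OF s] by blast
  obtain M where M: "\<And>p. p \<in> S \<Longrightarrow> norm p \<le> r \<Longrightarrow> norm (out (F p)) \<le> M" using bound by blast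
  obtain C where C: "\<And>p. norm (out p) \<le> norm p * C" using out.bounded by blast
  have "norm (out (s t1) - out (s t0)) \<le> M * (t1 - t0)" if t: "0 \<le> t0" "t0 \<le> t1" for t0 t1
  proof -
    \<comment> \<open>The increment may vanish, and then \<open>u = 0\<close>; hence only
      \<open>norm u \<le> 1\<close>.\<close>
    define u where "u = sgn (out (s t1) - out (s t0))"
    have u: "norm u \<le> 1" by (simp add: u_def norm_sgn)
    have inner_u: "v \<bullet> u \<le> norm v" "\<bar>v \<bullet> u\<bar> \<le> norm v" for v
      using Cauchy_Schwarz_ineq2[of v u] mult_left_le[OF u norm_ge_zero[of v]] by linarith+
    have "out (s t1) \<bullet> u - out (s t0) \<bullet> u \<le> M * (t1 - t0)"
    proof (rule abs_continuous_on_increment_le[OF _ t(2), of "\<lambda>t. out (s t) \<bullet> u"])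
      have "abs_continuous_on {0..t1 + 1} s" using s t by (auto simp: caratheodory_solution_def)
      then have "abs_continuous_on {t0..t1} s" using t by (auto elim: abs_continuous_on_subset)
      then show "abs_continuous_on {t0..t1} (\<lambda>t. out (s t) \<bullet> u)"
      proof (rule abs_continuous_on_compose)
        show "norm (out (s t) \<bullet> u - out (s t') \<bullet> u) \<le> C * norm (s t - s t')" for t t'
          using inner_u(2)[of "out (s t - s t')"] C[of "s t - s t'"]
          by (simp add: out.diff inner_diff_left mult.commute)
      qed
      have "AE t in lborel. 0 < t \<longrightarrow> (s has_vector_derivative F (s t)) (at t)"
        using s by (simp add: caratheodory_solution_def)
      then show "AE t in lborel. t0 < t \<and> t < t1 \<longrightarrow>
          (\<exists>D. ((\<lambda>t. out (s t) \<bullet> u) has_vector_derivative D) (at t) \<and> D \<le> M)"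
      proof (eventually_elim, intro impI exI conjI)
        fix t assume *: "0 < t \<longrightarrow> (s has_vector_derivative F (s t)) (at t)" and tt: "t0 < t \<and> t < t1"
        have "bounded_linear (\<lambda>p. out p \<bullet> u)"
          by (intro bounded_linear_inner_left_comp out)
        then show "((\<lambda>t. out (s t) \<bullet> u) has_vector_derivative out (F (s t)) \<bullet> u) (at t)"
          using * tt t bounded_linear.has_vector_derivative by fastforce
        have "s t \<in> S" "norm (s t) \<le> r" using s tt t r by (auto simp: caratheodory_solution_def)
        then show "out (F (s t)) \<bullet> u \<le> M" using inner_u(1)[of "out (F (s t))"] M[of "s t"] by linarith
      qed
    qed
    moreover have "out (s t1) \<bullet> u - out (s t0) \<bullet> u = norm (out (s t1) - out (s t0))"
      unfolding inner_diff_left[symmetric] u_def sgn_div_norm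
      by (cases "out (s t1) = out (s t0)")
        (simp_all add: power2_norm_eq_inner[symmetric] power2_eq_square)
    ultimately show ?thesis by simp
  qed
  then show ?thesis using that by blast
qed

text \<open>Each time the output is \<open>\<epsilon>\<close> away from \<open>v\<close>, it stays \<open>\<epsilon> / 2\<close> away for a time \<open>\<tau>\<close>
  that does not depend on when this happens, and this costs a fixed amount of energy.\<close>

lemma output_tendsto:
  assumes out: "bounded_linear out"
    and bound: "\<And>r. \<exists>M. \<forall>p\<in>S. norm p \<le> r \<longrightarrow> norm (out (F p)) \<le> M"
    and W_continuous: "continuous_on UNIV W" and W_zero: "\<And>y. W y = 0 \<Longrightarrow> y = v"
    and s: "caratheodory_solution F S s"
  shows "((\<lambda>t. out (s t)) \<longlongrightarrow> v) at_top"
proof (rule ccontr)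
  assume "\<not> ?thesis"
  then obtain \<epsilon> where "\<epsilon> > 0" and "\<not> (\<forall>\<^sub>F t in at_top. dist (out (s t)) v < \<epsilon>)"
    unfolding tendsto_iff by blast
  then have far: "\<exists>t\<ge>T. \<epsilon> \<le> dist (out (s t)) v" for T
    unfolding eventually_at_top_linorder by (meson not_le)
  obtain r where r: "\<And>t. 0 \<le> t \<Longrightarrow> norm (s t) \<le> r" using solution_bounded[OF s] by blast
  obtain C where C: "C > 0" "\<And>p. norm (out p) \<le> norm p * C"
    using bounded_linear.pos_bounded[OF out] by blast
  obtain M where M: "\<And>t t'. 0 \<le> t \<Longrightarrow> t \<le> t' \<Longrightarrow> norm (out (s t') - out (s t)) \<le> M * (t' - t)"
    using output_lipschitz[OF out bound s] by blast
  \<comment> \<open>A compact set that contains every output value at distance at least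
    \<open>\<epsilon> / 2\<close> from \<open>v\<close>. \<open>W\<close> is continuous and nonzero
    on it, so its minimum \<open>m\<close> there is positive.\<close>
  define A where "A = cball 0 (r * C) - ball v (\<epsilon> / 2)"
  have outA: "out (s t) \<in> A" if "0 \<le> t" "\<epsilon> / 2 \<le> dist (out (s t)) v" for t
    using order_trans[OF C(2)[of "s t"] mult_right_mono[OF r[OF that(1)] less_imp_le[OF C(1)]]] that(2)
    by (auto simp: A_def dist_commute)
  have "compact A" by (simp add: A_def compact_diff)
  moreover have "A \<noteq> {}" using far[of 0] outA \<open>\<epsilon> > 0\<close> by fastforce
  ultimately obtain y0 where y0: "y0 \<in> A" "\<And>y. y \<in> A \<Longrightarrow> W y0 \<le> W y"
    using continuous_attains_inf[of A W] W_continuous continuous_on_subset by blast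
  define m where "m = W y0"
  have "y0 \<noteq> v" using y0(1) \<open>\<epsilon> > 0\<close> by (auto simp: A_def)
  then have "m > 0" using W_zero[of y0] W_nonneg[of y0] by (auto simp: m_def less_le)
  \<comment> \<open>At speed at most \<open>\<bar>M\<bar> + 1\<close> the output moves by at most
    \<open>\<epsilon> / 2\<close> during the time \<open>\<tau>\<close>. The added \<open>1\<close>
    keeps the divisor positive.\<close>
  define \<tau> where "\<tau> = \<epsilon> / (2 * (\<bar>M\<bar> + 1))"
  have "\<tau> > 0" using \<open>\<epsilon> > 0\<close> by (simp add: \<tau>_def)
  \<comment> \<open>After \<open>n\<close> excursions at least \<open>n * (2 * m * \<tau>)\<close>
    of the energy is spent. For large \<open>n\<close> this exceeds the initial energy, although the
    energy is nonnegative.\<close>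
  have "\<exists>t\<ge>0. B (s t - e) (s t - e) \<le> B (s 0 - e) (s 0 - e) - real n * (2 * m * \<tau>)" for n
  proof (induction n)
    case 0
    then show ?case by auto
  next
    case (Suc n)
    then obtain t where t: "t \<ge> 0" "B (s t - e) (s t - e) \<le> B (s 0 - e) (s 0 - e) - real n * (2 * m * \<tau>)"
      by blast
    obtain t0 where t0: "t0 \<ge> t" "\<epsilon> \<le> dist (out (s t0)) v" using far by blast
    have "B (s t0 - e) (s t0 - e) \<le> B (s t - e) (s t - e)"
      using energy_decrease[OF s t(1) t0(1), where m = 0] W_nonneg by simp
    moreover have "B (s (t0 + \<tau>) - e) (s (t0 + \<tau>) - e) - B (s t0 - e) (s t0 - e)
        \<le> - 2 * m * (t0 + \<tau> - t0)"
    proof (rule energy_decrease[OF s])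
      fix t' assume t': "t0 < t'" "t' < t0 + \<tau>"
      have "norm (out (s t') - out (s t0)) \<le> M * (t' - t0)" using M t t0 t' by auto
      also have "\<dots> \<le> (\<bar>M\<bar> + 1) * \<tau>" using t' by (intro mult_mono) auto
      also have "\<dots> = \<epsilon> / 2" by (simp add: \<tau>_def field_simps)
      finally have "\<epsilon> / 2 \<le> dist (out (s t')) v"
        using t0(2) dist_triangle[of "out (s t0)" v "out (s t')"]
        by (simp add: dist_norm norm_minus_commute)
      then show "m \<le> W (out (s t'))" unfolding m_def using t t0 t' by (intro y0(2) outA) auto
    qed (use t t0 \<open>\<tau> > 0\<close> in auto)
    ultimately have "B (s (t0 + \<tau>) - e) (s (t0 + \<tau>) - e)
        \<le> B (s 0 - e) (s 0 - e) - real (Suc n) * (2 * m * \<tau>)"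
      using t(2) by (simp add: algebra_simps)
    then show ?case using t t0 \<open>\<tau> > 0\<close> by (intro exI[of _ "t0 + \<tau>"]) auto
  qed
  moreover obtain n where "B (s 0 - e) (s 0 - e) < real n * (2 * m * \<tau>)"
    using reals_Archimedean3[of "2 * m * \<tau>"] \<open>m > 0\<close> \<open>\<tau> > 0\<close> by auto
  moreover have "0 \<le> B p p" for p
    using coercive(2)[of p] coercive(1) by (meson less_imp_le mult_nonneg_nonneg order_trans zero_le_power2)
  ultimately show False by (smt (verit, best))
qed

end

subsection \<open>Gradients and convexity\<close>

text \<open>Gives the definite description its meaning: the derivative is represented by the vector
  of its values on the basis, and a linear functional has only one representing vector.\<close>

lemma gderiv_gradient:
  fixes F :: "'b::euclidean_space \<Rightarrow> real"
  assumes "F differentiable (at x)"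
  shows "GDERIV F x :> gradient F x"
proof -
  obtain F' where F': "(F has_derivative F') (at x)" using assms by (auto simp: differentiable_def)
  then interpret bounded_linear F' by (rule has_derivative_bounded_linear)
  define D where "D = (\<Sum>b\<in>Basis. F' b *\<^sub>R b)"
  have "F' = (\<lambda>h. h \<bullet> D)"
  proof
    fix h
    have "F' h = F' (\<Sum>b\<in>Basis. (h \<bullet> b) *\<^sub>R b)" by (simp add: euclidean_representation)
    also have "\<dots> = h \<bullet> D" by (simp add: sum scale D_def inner_sum_right mult.commute)
    finally show "F' h = h \<bullet> D" .
  qed
  then have D: "GDERIV F x :> D" using F' by (simp add: gderiv_def)
  moreover have "D' = D" if "GDERIV F x :> D'" for D'
  proof -
    have "(\<lambda>h. h \<bullet> D') = (\<lambda>h. h \<bullet> D)"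
      using has_derivative_unique that D unfolding gderiv_def by blast
    then show ?thesis by (metis vector_eq_ldot)
  qed
  ultimately show ?thesis unfolding gradient_def by (rule theI)
qed

lemma gderiv_along_line:
  fixes F :: "'b::real_inner \<Rightarrow> real"
  assumes "GDERIV F x :> D"
  shows "((\<lambda>t. F (x + t *\<^sub>R v)) has_real_derivative D \<bullet> v) (at 0)"
proof -
  have "((\<lambda>t. x + t *\<^sub>R v) has_derivative (\<lambda>t. t *\<^sub>R v)) (at 0)"
    by (auto intro!: derivative_eq_intros)
  moreover have "(F has_derivative (\<lambda>h. h \<bullet> D)) (at (x + 0 *\<^sub>R v))"
    using assms by (simp add: gderiv_def)
  ultimately have "((\<lambda>t. F (x + t *\<^sub>R v)) has_derivative (\<lambda>t. t *\<^sub>R v \<bullet> D)) (at 0)"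
    by (rule has_derivative_compose)
  then show ?thesis
    by (simp add: has_field_derivative_def inner_commute mult_commute_abs)
qed

text \<open>Along the direction \<open>D\<close> itself the difference quotients are at most
  \<open>L * norm D\<close> and tend to \<open>D \<bullet> D\<close>.\<close>

lemma norm_gderiv_le_lipschitz:
  fixes F :: "'b::real_inner \<Rightarrow> real"
  assumes L: "L-lipschitz_on UNIV F" and D: "GDERIV F x :> D"
  shows "norm D \<le> L"
proof -
  have "((\<lambda>t. (F (x + t *\<^sub>R D) - F x) / t) \<longlongrightarrow> D \<bullet> D) (at 0)"
    using gderiv_along_line[OF D, of D] by (simp add: DERIV_def)
  moreover have "\<forall>\<^sub>F t in at (0 :: real). (F (x + t *\<^sub>R D) - F x) / t \<le> L * norm D"
  proof (rule eventually_at_ball'[OF zero_less_one, THEN eventually_mono])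
    fix t :: real assume "t \<in> ball 0 1 \<and> t \<noteq> 0 \<and> t \<in> UNIV"
    then have "\<bar>F (x + t *\<^sub>R D) - F x\<bar> / \<bar>t\<bar> \<le> L * norm D"
      using lipschitz_onD[OF L, of "x + t *\<^sub>R D" x] by (simp add: dist_norm field_simps)
    then show "(F (x + t *\<^sub>R D) - F x) / t \<le> L * norm D"
      by (metis abs_divide abs_ge_self order_trans)
  qed
  ultimately have "D \<bullet> D \<le> L * norm D" by (rule tendsto_upperbound) simp
  then have "norm D * norm D \<le> L * norm D" by (simp add: power2_norm_eq_inner[symmetric] power2_eq_square)
  moreover have "0 \<le> L" using L by (rule lipschitz_on_nonneg)
  ultimately show ?thesis by (cases "norm D = 0") (auto simp: mult_le_cancel_right)
qed

text \<open>Restriction to the line through \<open>x\<close> and \<open>y\<close> reduces this to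
  the tangent inequality for convex functions of one variable.\<close>

lemma convex_on_above_tangent:
  fixes F :: "'b::real_inner \<Rightarrow> real"
  assumes F: "convex_on UNIV F" and D: "GDERIV F x :> D"
  shows "F x + D \<bullet> (y - x) \<le> F y"
proof -
  have "convex_on UNIV (\<lambda>t::real. F (x + t *\<^sub>R (y - x)))"
  proof (rule convex_onI)
    fix t s r :: real assume t: "0 < t" "t < 1"
    have "x + ((1 - t) *\<^sub>R s + t *\<^sub>R r) *\<^sub>R (y - x)
        = (1 - t) *\<^sub>R (x + s *\<^sub>R (y - x)) + t *\<^sub>R (x + r *\<^sub>R (y - x))"
      by (simp add: algebra_simps)
    then show "F (x + ((1 - t) *\<^sub>R s + t *\<^sub>R r) *\<^sub>R (y - x))
        \<le> (1 - t) * F (x + s *\<^sub>R (y - x)) + t * F (x + r *\<^sub>R (y - x))"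
      using convex_onD[OF F, of t] t by simp
  qed simp
  from convex_on_imp_above_tangent[OF this, of 0 1, OF _ _ _ gderiv_along_line[OF D, of "y - x"]]
  show ?thesis by simp
qed

lemma gderiv_eq_zero_at_min:
  fixes F :: "'b::real_inner \<Rightarrow> real"
  assumes "GDERIV F x :> D" and "\<And>y. F x \<le> F y"
  shows "D = 0"
proof -
  have "(\<lambda>h. h \<bullet> D) = (\<lambda>h. 0)"
    using assms by (intro differential_zero_maxmin[of x UNIV F]) (auto simp: gderiv_def)
  then show ?thesis by (metis inner_eq_zero_iff)
qed

text \<open>Minimality is compared at the midpoint only. Thus the same lemma serves the constrained
  problem, where the midpoint is feasible, and the unconstrained minimization of the
  Lagrangian.\<close>

lemma strictly_convex_on_minimizer_unique:
  assumes F: "strictly_convex_on S F" and x: "x \<in> S" "y \<in> S" "F x = F y"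
    and min: "F x \<le> F ((1 / 2) *\<^sub>R x + (1 / 2) *\<^sub>R y)"
  shows "x = y"
proof (rule ccontr)
  assume "x \<noteq> y"
  then have "\<forall>t. 0 < t \<and> t < 1 \<longrightarrow> F ((1 - t) *\<^sub>R x + t *\<^sub>R y) < (1 - t) * F x + t * F y"
    using F x(1,2) unfolding strictly_convex_on_def by blast
  from this[rule_format, of "1 / 2"] show False using x(3) min by simp
qed

lemma strictly_convex_on_add:
  assumes "strictly_convex_on S F" and "convex_on S G"
  shows "strictly_convex_on S (\<lambda>x. F x + G x)"
  unfolding strictly_convex_on_def
proof (intro conjI ballI allI impI)
  show "convex S" using assms by (simp add: strictly_convex_on_def)
  fix x y and t :: real assume xy: "x \<in> S" "y \<in> S" "x \<noteq> y \<and> 0 < t \<and> t < 1"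
  have "F ((1 - t) *\<^sub>R x + t *\<^sub>R y) < (1 - t) * F x + t * F y"
    using assms(1) xy by (simp add: strictly_convex_on_def)
  moreover have "G ((1 - t) *\<^sub>R x + t *\<^sub>R y) \<le> (1 - t) * G x + t * G y"
    using xy by (intro convex_onD[OF assms(2)]) auto
  ultimately show "F ((1 - t) *\<^sub>R x + t *\<^sub>R y) + G ((1 - t) *\<^sub>R x + t *\<^sub>R y)
      < (1 - t) * (F x + G x) + t * (F y + G y)"
    by (simp add: algebra_simps)
qed

lemma convex_on_sum_fun:
  assumes "finite Q" and "\<And>q. q \<in> Q \<Longrightarrow> convex_on UNIV (G q)"
  shows "convex_on UNIV (\<lambda>x. \<Sum>q\<in>Q. G q x)"
  using assms by (induction Q rule: finite_induct) (auto intro!: convex_on_add simp: convex_on_const)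

lemma convex_on_affine:
  assumes "\<And>x. H x = b \<bullet> x + d"
  shows "convex_on UNIV (H :: 'b::real_inner \<Rightarrow> real)"
  by (rule convex_onI) (simp_all add: assms inner_add_right algebra_simps)

subsection \<open>Multipliers under Slater's condition\<close>

text \<open>The epigraph-type set is separated from the origin by a vector of its own span: a normal
  with vanishing objective component would then be orthogonal to that span. This replaces the
  linear independence of the equality constraints.\<close>

lemma slater_multipliers:
  fixes F :: "'b::euclidean_space \<Rightarrow> real" and G :: "'b \<Rightarrow> real^'p::finite" and H :: "'b \<Rightarrow> real^'q::finite"
  assumes F: "convex_on UNIV F" and G: "\<And>p. convex_on UNIV (\<lambda>y. G y $ p)"
    and H: "\<And>x y t. H ((1 - t) *\<^sub>R x + t *\<^sub>R y) = (1 - t) *\<^sub>R H x + t *\<^sub>R H y"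
    and slater: "\<And>p. G y0 $ p < 0" "H y0 = 0"
    and min: "\<And>y. (\<And>p. G y $ p \<le> 0) \<Longrightarrow> H y = 0 \<Longrightarrow> F ystar \<le> F y"
  obtains lam mu where "\<And>p. 0 \<le> lam $ p" "\<And>y. F ystar \<le> F y + lam \<bullet> G y + mu \<bullet> H y"
proof -
  \<comment> \<open>The first two blocks lie strictly above objective gap and constraint values, the
    third is attained exactly. Then \<open>0 \<in> S\<close> would be a feasible point better than
    \<open>ystar\<close>.\<close>
  define S where "S = {(s, r, q). \<exists>y. F y - F ystar < s \<and> (\<forall>p. G y $ p < r $ p) \<and> q = H y}"
  have conv: "convex S"
    unfolding convex_alt
  proof (intro ballI allI impI)
    fix P Q :: "real \<times> (real^'p) \<times> (real^'q)" and t :: real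
    assume "P \<in> S" "Q \<in> S" and t: "0 \<le> t \<and> t \<le> 1"
    then obtain s r y s' r' y' where P: "P = (s, r, H y)" "F y - F ystar < s" "\<And>p. G y $ p < r $ p"
      and Q: "Q = (s', r', H y')" "F y' - F ystar < s'" "\<And>p. G y' $ p < r' $ p"
      unfolding S_def by blast
    have less: "(1 - t) * a + t * a' < (1 - t) * b + t * b'" if "a < b" "a' < b'" for a a' b b' :: real
    proof (cases "t = 0")
      case False
      have "(1 - t) * a \<le> (1 - t) * b" using that t by (intro mult_left_mono) auto
      moreover have "t * a' < t * b'" using that t False by simp
      ultimately show ?thesis by linarith
    qed (use that in simp)
    let ?y = "(1 - t) *\<^sub>R y + t *\<^sub>R y'"
    have "F ?y - F ystar \<le> (1 - t) * (F y - F ystar) + t * (F y' - F ystar)"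
      using convex_onD[OF F, of t y y'] t by (simp add: algebra_simps)
    also have "\<dots> < (1 - t) * s + t * s'" by (rule less[OF P(2) Q(2)])
    finally have 1: "F ?y - F ystar < (1 - t) * s + t * s'" .
    have 2: "G ?y $ p < (1 - t) * r $ p + t * r' $ p" for p
      using convex_onD[OF G[of p], of t y y'] less[OF P(3)[of p] Q(3)[of p]] t by simp
    show "(1 - t) *\<^sub>R P + t *\<^sub>R Q \<in> S"
      unfolding S_def P(1) Q(1) using 1 2 H[of t y y'] by (auto intro!: exI[of _ ?y])
  qed
  have ge: "(F y - F ystar + \<epsilon>, G y + \<eta> *\<^sub>R 1, H y) \<in> S" if "0 < \<epsilon>" "0 < \<eta>" for y \<epsilon> \<eta>
    using that by (auto simp: S_def intro!: exI[of _ y])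
  have "S \<noteq> {}" using ge[of 1 1] by auto
  moreover have "0 \<notin> S"
  proof
    assume "0 \<in> S"
    then obtain y where "F y < F ystar" "\<And>p. G y $ p < 0" "H y = 0"
      by (auto simp: S_def zero_prod_def)
    then show False using min[of y] by (meson less_imp_le not_le)
  qed
  ultimately obtain v where v: "v \<in> span S" "v \<noteq> 0" "\<And>x. x \<in> S \<Longrightarrow> 0 \<le> v \<bullet> x"
    using separating_hyperplane_set_0_inspan[OF conv] by blast
  obtain \<sigma> lam mu where v_eq: "v = (\<sigma>, lam, mu)" by (cases v) auto
  have sep: "0 \<le> \<sigma> * s + lam \<bullet> r + mu \<bullet> H y" if "F y - F ystar < s" "\<And>p. G y $ p < r $ p" for s r y
  proof -
    have "(s, r, H y) \<in> S" using that by (auto simp: S_def)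
    from v(3)[OF this] show ?thesis by (simp add: v_eq add.assoc)
  qed
  \<comment> \<open>The first two blocks of points of \<open>S\<close> may grow without bound, so a
    negative coefficient there would violate the separation far out. This is used for
    \<open>\<sigma>\<close> and for every component of \<open>lam\<close>.\<close>
  have limit: "0 \<le> a" if "\<And>t. t > 0 \<Longrightarrow> 0 \<le> a * t + b" for a b :: real
  proof (rule ccontr)
    assume "\<not> 0 \<le> a"
    then have "0 \<le> a * ((\<bar>b\<bar> + 1) / - a) + b" by (intro that divide_pos_pos) auto
    moreover have "a * ((\<bar>b\<bar> + 1) / - a) = - (\<bar>b\<bar> + 1)" using \<open>\<not> 0 \<le> a\<close> by simp
    ultimately show False by linarith
  qed
  have \<sigma>: "0 \<le> \<sigma>"
  proof (rule limit)
    fix t :: real assume "t > 0"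
    then have "0 \<le> \<sigma> * (F y0 - F ystar + t) + lam \<bullet> 0 + mu \<bullet> H y0"
      using slater(1) by (intro sep) auto
    then show "0 \<le> \<sigma> * t + \<sigma> * (F y0 - F ystar)" using slater(2) by (simp add: algebra_simps)
  qed
  have lam: "0 \<le> lam $ p" for p
  proof (rule limit)
    fix t :: real assume "t > 0"
    then have "G y0 $ p' < axis p t $ p'" for p'
      using slater(1)[of p'] by (auto simp: axis_def)
    then have "0 \<le> \<sigma> * (F y0 - F ystar + 1) + lam \<bullet> axis p t + mu \<bullet> H y0"
      by (intro sep) auto
    then show "0 \<le> lam $ p * t + \<sigma> * (F y0 - F ystar + 1)"
      using slater(2) by (simp add: inner_axis add.commute)
  qed
  have key: "0 \<le> \<sigma> * (F y - F ystar) + lam \<bullet> G y + mu \<bullet> H y" for y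
  proof (rule field_le_epsilon)
    fix \<epsilon> :: real assume "0 < \<epsilon>"
    \<comment> \<open>Points with equality in the first two blocks are only limits of points of
      \<open>S\<close>. A shift by \<open>\<eta>\<close> enters \<open>S\<close> and changes the
      functional by \<open>\<eta> * (\<sigma> + lam \<bullet> 1)\<close>, which is at most
      \<open>\<epsilon>\<close>; the \<open>1\<close> keeps the divisor positive.\<close>
    define \<eta> where "\<eta> = \<epsilon> / (\<sigma> + lam \<bullet> 1 + 1)"
    have "0 \<le> lam \<bullet> 1" using lam by (simp add: inner_vec_def sum_nonneg)
    then have pos: "0 < \<sigma> + lam \<bullet> 1 + 1" using \<sigma> by linarith
    then have \<eta>: "\<eta> > 0" "\<eta> * (\<sigma> + lam \<bullet> 1 + 1) = \<epsilon>" using \<open>0 < \<epsilon>\<close> by (auto simp: \<eta>_def)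
    have "0 \<le> \<sigma> * (F y - F ystar + \<eta>) + lam \<bullet> (G y + \<eta> *\<^sub>R 1) + mu \<bullet> H y"
      using \<eta>(1) by (intro sep) auto
    then show "0 \<le> \<sigma> * (F y - F ystar) + lam \<bullet> G y + mu \<bullet> H y + \<epsilon>"
      using \<eta> by (simp add: inner_add_right algebra_simps)
  qed
  have "\<sigma> \<noteq> 0"
  proof
    assume "\<sigma> = 0"
    have nonpos: "lam $ p * G y0 $ p \<le> 0" for p
      using lam[of p] slater(1)[of p] by (simp add: mult_nonneg_nonpos)
    have "0 \<le> (\<Sum>p\<in>UNIV. lam $ p * G y0 $ p)"
      using key[of y0] \<open>\<sigma> = 0\<close> slater(2) by (simp add: inner_vec_def)
    moreover have "(\<Sum>p\<in>UNIV. lam $ p * G y0 $ p) \<le> 0" using nonpos by (simp add: sum_nonpos)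
    ultimately have "\<forall>p. - (lam $ p * G y0 $ p) = 0"
      using sum_nonneg_eq_0_iff[of UNIV "\<lambda>p. - (lam $ p * G y0 $ p)"] nonpos
      by (simp add: sum_negf)
    then have "lam = 0" using slater(1) by (simp add: vec_eq_iff) (metis less_irrefl)
    \<comment> \<open>The affine map \<open>H\<close> vanishes at \<open>y0\<close>, so reflecting
      \<open>y\<close> in \<open>y0\<close> reverses the sign of \<open>H y\<close>; both signs
      satisfy the inequality \<open>key\<close>.\<close>
    have "mu \<bullet> H y = 0" for y
    proof -
      have "H ((1 - 2) *\<^sub>R y + 2 *\<^sub>R y0) = - H y" using H[of 2 y y0] slater(2) by simp
      then show ?thesis
        using key[of y] key[of "(1 - 2) *\<^sub>R y + 2 *\<^sub>R y0"] \<open>\<sigma> = 0\<close> \<open>lam = 0\<close> by simp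
    qed
    \<comment> \<open>So \<open>v\<close> is orthogonal to \<open>S\<close>, hence to
      \<open>span S\<close>, which contains \<open>v\<close> itself.\<close>
    then have "orthogonal v x" if "x \<in> S" for x
      using that by (auto simp: orthogonal_def v_eq S_def \<open>\<sigma> = 0\<close> \<open>lam = 0\<close>)
    then have "orthogonal v v" using orthogonal_to_span v(1) by blast
    then show False using v(2) by (simp add: orthogonal_def)
  qed
  then have "0 < \<sigma>" using \<sigma> by simp
  show ?thesis
  proof
    show "0 \<le> ((1 / \<sigma>) *\<^sub>R lam) $ p" for p using lam[of p] \<open>0 < \<sigma>\<close> by simp
    show "F ystar \<le> F y + ((1 / \<sigma>) *\<^sub>R lam) \<bullet> G y + ((1 / \<sigma>) *\<^sub>R mu) \<bullet> H y" for y
      using key[of y] \<open>0 < \<sigma>\<close> by (simp add: field_simps)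
  qed
qed

text \<open>The part \<open>q\<close> of \<open>v\<close> orthogonal to the range of
  \<open>E\<close> lies in the kernel of the transpose, so it is a multiple of the vector of ones.
  As the components of \<open>v\<close> sum to zero, \<open>q\<close> is orthogonal to
  \<open>v\<close> and therefore zero.\<close>

lemma range_matrix_eq_sum_zero:
  fixes E :: "real^'k::finite^'a::finite"
  assumes ker: "{v. transpose E *v v = 0} = {r *\<^sub>R 1 |r. True}" and v: "(\<Sum>i\<in>UNIV. v $ i) = 0"
  obtains z where "E *v z = v"
proof -
  have "subspace (range ((*v) E))"
    by (intro linear_subspace_image matrix_vector_mul_linear subspace_UNIV)
  then obtain p q where pq: "p \<in> range ((*v) E)" "\<And>w. w \<in> range ((*v) E) \<Longrightarrow> orthogonal q w" "v = p + q"
    using orthogonal_subspace_decomp_exists[of "range ((*v) E)" v] by (metis span_eq_iff)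
  have "(transpose E *v q) \<bullet> w = 0" for w
    using pq(2)[of "E *v w"] dot_lmul_matrix[of q E w]
    by (simp add: orthogonal_def transpose_matrix_vector)
  then have "transpose E *v q = 0" by (metis inner_eq_zero_iff)
  then obtain r where r: "q = r *\<^sub>R 1" using ker by blast
  have "q \<bullet> v = 0" using v by (simp add: r inner_vec_def flip: sum_distrib_left)
  moreover have "q \<bullet> p = 0" using pq(1,2) by (auto simp: orthogonal_def)
  ultimately have "q = 0" using pq(3) by (simp add: inner_add_right)
  then show ?thesis using pq(1,3) that by auto
qed

subsection \<open>The closed loop and its equilibria\<close>

text \<open>The signal \<zeta> of the interconnection in block form, with one vector for each
  controller and no Kronecker product.\<close>

definition coupling :: "real^'k^'a \<Rightarrow> real^'n^'a \<Rightarrow> real^'n^'k" where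
  "coupling E x = (\<chi> k. \<Sum>i\<in>UNIV. E $ i $ k *\<^sub>R x $ i)"

lemma unstack_transpose_kron:
  fixes E :: "real^'k::finite^'a::finite" and x :: "real^'n::finite^'a"
  shows "unstack (transpose (kron E (mat 1 :: real^'n^'n)) *v stack x) = coupling E x"
proof -
  have "unstack (transpose (kron E (mat 1 :: real^'n^'n)) *v stack x) $ k $ n = coupling E x $ k $ n" for k n
  proof -
    have "unstack (transpose (kron E (mat 1 :: real^'n^'n)) *v stack x) $ k $ n
        = (\<Sum>r\<in>UNIV \<times> UNIV. E $ fst r $ k * mat 1 $ snd r $ n * x $ fst r $ snd r)"
      by (simp add: unstack_def stack_def kron_def transpose_def matrix_vector_mult_def)
    also have "\<dots> = (\<Sum>i\<in>UNIV. \<Sum>m\<in>UNIV. E $ i $ k * mat 1 $ m $ n * x $ i $ m)"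
      unfolding sum.cartesian_product by (simp add: case_prod_unfold)
    also have "\<dots> = (\<Sum>i\<in>UNIV. \<Sum>m\<in>UNIV. if m = n then E $ i $ k * x $ i $ m else 0)"
      by (intro sum.cong refl) (simp add: mat_def)
    also have "\<dots> = coupling E x $ k $ n" by (simp add: coupling_def)
    finally show ?thesis .
  qed
  then show ?thesis unfolding vec_eq_iff by blast
qed

lemma unstack_kron:
  fixes E :: "real^'k::finite^'a::finite" and d :: "real^'n::finite^'k"
  shows "unstack (- (kron E (mat 1 :: real^'n^'n) *v stack d)) $ i = - (\<Sum>k\<in>UNIV. E $ i $ k *\<^sub>R d $ k)"
proof -
  have "unstack (- (kron E (mat 1 :: real^'n^'n) *v stack d)) $ i $ n
      = (- (\<Sum>k\<in>UNIV. E $ i $ k *\<^sub>R d $ k)) $ n" for n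
  proof -
    have "unstack (- (kron E (mat 1 :: real^'n^'n) *v stack d)) $ i $ n
        = - (\<Sum>r\<in>UNIV \<times> UNIV. E $ i $ fst r * mat 1 $ n $ snd r * d $ fst r $ snd r)"
      by (simp add: unstack_def stack_def kron_def matrix_vector_mult_def)
    also have "\<dots> = - (\<Sum>k\<in>UNIV. \<Sum>m\<in>UNIV. E $ i $ k * mat 1 $ n $ m * d $ k $ m)"
      unfolding sum.cartesian_product by (simp add: case_prod_unfold)
    also have "\<dots> = - (\<Sum>k\<in>UNIV. \<Sum>m\<in>UNIV. if m = n then E $ i $ k * d $ k $ m else 0)"
      by (intro arg_cong[of _ _ uminus] sum.cong refl) (auto simp: mat_def)
    also have "\<dots> = (- (\<Sum>k\<in>UNIV. E $ i $ k *\<^sub>R d $ k)) $ n" by simp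
    finally show ?thesis .
  qed
  then show ?thesis unfolding vec_eq_iff by blast
qed

text \<open>The interconnection is lossless: what the agents give up through \<open>E\<close> equals
  what the controllers receive. The mixed terms of the energy balance cancel for this
  reason.\<close>

lemma coupling_adjoint:
  fixes E :: "real^'k::finite^'a::finite" and x :: "real^'n::finite^'a"
  shows "(\<Sum>i\<in>UNIV. x $ i \<bullet> (\<Sum>k\<in>UNIV. E $ i $ k *\<^sub>R d $ k)) = (\<Sum>k\<in>UNIV. coupling E x $ k \<bullet> d $ k)"
  by (simp add: coupling_def inner_sum_left inner_sum_right) (rule sum.swap)

lemma coupling_diff:
  fixes E :: "real^'k::finite^'a::finite" and x y :: "real^'n::finite^'a"
  shows "coupling E (x - y) = coupling E x - coupling E y"
  by (simp add: coupling_def vec_eq_iff algebra_simps sum_subtractf)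

lemma coupling_consensus:
  fixes E :: "real^'k::finite^'a::finite" and y :: "real^'n::finite"
  assumes "{v. transpose E *v v = 0} = {r *\<^sub>R 1 |r. True}"
  shows "coupling E (\<chi> i. y) = 0"
proof -
  have "1 \<in> {r *\<^sub>R (1 :: real^'a) |r. True}" by (auto intro: exI[of _ 1])
  then have "transpose E *v 1 = 0" using assms by blast
  then have "(\<Sum>i\<in>UNIV. E $ i $ k) = 0" for k
    by (simp add: vec_eq_iff matrix_vector_mult_def transpose_def)
  then show ?thesis by (simp add: coupling_def vec_eq_iff flip: sum_distrib_right)
qed

lemma coupling_zero_imp_consensus:
  fixes E :: "real^'k::finite^'a::finite" and x :: "real^'n::finite^'a"
  assumes ker: "{v. transpose E *v v = 0} = {r *\<^sub>R 1 |r. True}" and x: "coupling E x = 0"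
  obtains y where "x = (\<chi> i. y)"
proof -
  have "\<exists>r. \<forall>i. x $ i $ n = r" for n
  proof -
    have "transpose E *v (\<chi> i. x $ i $ n) = 0"
      using x by (simp add: coupling_def vec_eq_iff matrix_vector_mult_def transpose_def)
    then obtain r where "(\<chi> i. x $ i $ n) = r *\<^sub>R 1" using ker by blast
    then show ?thesis by (auto simp: vec_eq_iff)
  qed
  then obtain r where "\<And>n i. x $ i $ n = r n" by metis
  then have "x = (\<chi> i. \<chi> n. r n)" by (simp add: vec_eq_iff)
  then show ?thesis using that by blast
qed

text \<open>The kernel condition concerns scalar entries; the system is solved separately in each of
  the \<open>'n\<close> coordinates, and the solutions are assembled.\<close>

lemma coupling_range:
  fixes E :: "real^'k::finite^'a::finite" and v :: "'a \<Rightarrow> real^'n::finite"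
  assumes ker: "{v. transpose E *v v = 0} = {r *\<^sub>R 1 |r. True}" and v: "(\<Sum>i\<in>UNIV. v i) = 0"
  obtains z :: "real^'n^'k" where "\<And>i. (\<Sum>k\<in>UNIV. E $ i $ k *\<^sub>R z $ k) = v i"
proof -
  have "\<exists>w. E *v w = (\<chi> i. v i $ n)" for n
  proof -
    have "(\<Sum>i\<in>UNIV. (\<chi> i. v i $ n) $ i) = 0"
      using v by (simp add: vec_eq_iff)
    from range_matrix_eq_sum_zero[OF ker this] show ?thesis by blast
  qed
  then obtain w where w: "\<And>n. E *v w n = (\<chi> i. v i $ n)" by metis
  have "(\<Sum>k\<in>UNIV. E $ i $ k *\<^sub>R (\<chi> k. \<chi> n. w n $ k) $ k) = v i" for i
    using w by (simp add: vec_eq_iff matrix_vector_mult_def)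
  then show ?thesis using that by blast
qed

section \<open>Lagrangians, KKT points and equilibria\<close>

locale distributed_optimization =
  fixes f :: "'a::finite \<Rightarrow> real^'n::finite \<Rightarrow> real"
    and g :: "'a \<Rightarrow> 'l::finite \<Rightarrow> real^'n \<Rightarrow> real"
    and h :: "'a \<Rightarrow> 'm::finite \<Rightarrow> real^'n \<Rightarrow> real"
    and a :: "'a \<Rightarrow> 'm \<Rightarrow> real^'n"
    and c :: "'a \<Rightarrow> 'm \<Rightarrow> real"
    and Cin :: "'a \<Rightarrow> 'l set"
    and Ceq :: "'a \<Rightarrow> 'm set"
    and \<alpha> :: "'a \<Rightarrow> real"
    and \<beta> :: "'k::finite \<Rightarrow> real"
    and E :: "real^'k^'a"
    and ystar :: "real^'n"
  assumes f_differentiable: "\<And>i y. f i differentiable (at y)"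
    and g_differentiable: "\<And>i l y. l \<in> Cin i \<Longrightarrow> g i l differentiable (at y)"
    and f_lipschitz: "\<And>i. \<exists>L. L-lipschitz_on UNIV (f i)"
    and g_lipschitz: "\<And>i l. l \<in> Cin i \<Longrightarrow> \<exists>L. L-lipschitz_on UNIV (g i l)"
    and h_lipschitz: "\<And>i j. j \<in> Ceq i \<Longrightarrow> \<exists>L. L-lipschitz_on UNIV (h i j)"
    and f_convex: "\<And>i. convex_on UNIV (f i)"
    and g_convex: "\<And>i l. l \<in> Cin i \<Longrightarrow> convex_on UNIV (g i l)"
    and h_affine: "\<And>i j y. j \<in> Ceq i \<Longrightarrow> h i j y = a i j \<bullet> y + c i j"
    and sum_strictly_convex: "strictly_convex_on UNIV (\<lambda>y. \<Sum>i\<in>UNIV. f i y)"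
    and slater: "slater g h Cin Ceq"
    and minimizer: "is_arg_min (\<lambda>y. \<Sum>i\<in>UNIV. f i y) (feasible g h Cin Ceq) ystar"
    and alpha_pos: "\<And>i. 0 < \<alpha> i"
    and beta_pos: "\<And>k. 0 < \<beta> k"
    and ker_E: "{v. transpose E *v v = 0} = {r *\<^sub>R 1 |r. True}"
begin

abbreviation "\<L> \<equiv> lagrangian f g h Cin Ceq"

abbreviation "\<D> i lam mu x \<equiv> gradient (\<lambda>\<xi>. \<L> i \<xi> lam mu) x"

lemma feasible_ystar: "feasible g h Cin Ceq ystar"
  using minimizer by (simp add: is_arg_min_def)

lemma ystar_le: "feasible g h Cin Ceq y \<Longrightarrow> (\<Sum>i\<in>UNIV. f i ystar) \<le> (\<Sum>i\<in>UNIV. f i y)"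
  using minimizer by (auto simp: is_arg_min_linorder)

lemma closed_loop_eq:
  "closed_loop f g h Cin Ceq \<alpha> \<beta> E (x, lam, mu, z) =
    (\<chi> i. - \<alpha> i *\<^sub>R (\<D> i (lam $ i) (mu $ i) (x $ i)
              + (\<Sum>k\<in>UNIV. E $ i $ k *\<^sub>R (z $ k + \<beta> k *\<^sub>R coupling E x $ k))),
     \<chi> i. \<chi> l. if l \<notin> Cin i \<or> lam $ i $ l = 0 \<and> g i l (x $ i) < 0 then 0 else g i l (x $ i),
     \<chi> i. \<chi> j. if j \<in> Ceq i then h i j (x $ i) else 0,
     \<chi> k. \<beta> k *\<^sub>R coupling E x $ k)"
  unfolding closed_loop_def Let_def prod.case unstack_transpose_kron unstack_kron
  by (simp add: scaleR_add_right)

lemma lagrangian_gderiv: "GDERIV (\<lambda>\<xi>. \<L> i \<xi> lam mu) x :> \<D> i lam mu x"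
proof (rule gderiv_gradient)
  have "h i j differentiable (at x)" if "j \<in> Ceq i" for j
  proof -
    have "h i j = (\<lambda>y. a i j \<bullet> y + c i j)" using h_affine[OF that] by auto
    then show ?thesis by simp
  qed
  then show "(\<lambda>\<xi>. \<L> i \<xi> lam mu) differentiable (at x)"
    unfolding lagrangian_def
    by (intro differentiable_add differentiable_sum differentiable_mult ballI
        f_differentiable g_differentiable) auto
qed

lemma multiplier_part_convex:
  assumes "\<And>l. l \<in> Cin i \<Longrightarrow> 0 \<le> lam $ l"
  shows "convex_on UNIV (\<lambda>x. (\<Sum>l\<in>Cin i. lam $ l * g i l x) + (\<Sum>j\<in>Ceq i. mu $ j * h i j x))"
proof -
  have h: "convex_on UNIV (\<lambda>x. mu $ j * h i j x)" if "j \<in> Ceq i" for j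
    by (rule convex_on_affine[of _ "mu $ j *\<^sub>R a i j" "mu $ j * c i j"])
      (simp add: h_affine[OF that] algebra_simps)
  show ?thesis
    by (intro convex_on_add convex_on_sum_fun h) (auto intro: convex_on_cmul assms g_convex)
qed

lemma lagrangian_convex:
  assumes "\<And>l. l \<in> Cin i \<Longrightarrow> 0 \<le> lam $ l"
  shows "convex_on UNIV (\<lambda>x. \<L> i x lam mu)"
  unfolding lagrangian_def add.assoc
  by (intro convex_on_add f_convex multiplier_part_convex assms)

lemma lagrangian_above_tangent:
  assumes "\<And>l. l \<in> Cin i \<Longrightarrow> 0 \<le> lam $ l"
  shows "\<L> i x lam mu + \<D> i lam mu x \<bullet> (y - x) \<le> \<L> i y lam mu"
  by (rule convex_on_above_tangent[OF lagrangian_convex[OF assms] lagrangian_gderiv])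

lemma lagrangian_le_objective:
  assumes "feasible g h Cin Ceq y" and "\<And>l. l \<in> Cin i \<Longrightarrow> 0 \<le> lam $ l"
  shows "\<L> i y lam mu \<le> f i y"
proof -
  have "(\<Sum>l\<in>Cin i. lam $ l * g i l y) \<le> 0"
    using assms by (intro sum_nonpos mult_nonneg_nonpos) (auto simp: feasible_def)
  moreover have "(\<Sum>j\<in>Ceq i. mu $ j * h i j y) = 0"
    using assms(1) by (simp add: feasible_def)
  ultimately show ?thesis by (simp add: lagrangian_def)
qed

lemma lagrangian_eq_objective:
  assumes "feasible g h Cin Ceq y" and "\<And>l. l \<in> Cin i \<Longrightarrow> lam $ l * g i l y = 0"
  shows "\<L> i y lam mu = f i y"
proof -
  have "(\<Sum>l\<in>Cin i. lam $ l * g i l y) = 0" using assms(2) by (rule sum.neutral[OF ballI])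
  moreover have "(\<Sum>j\<in>Ceq i. mu $ j * h i j y) = 0"
    using assms(1) by (simp add: feasible_def)
  ultimately show ?thesis by (simp add: lagrangian_def)
qed

lemma sum_lagrangian_strictly_convex:
  assumes "\<And>i l. l \<in> Cin i \<Longrightarrow> 0 \<le> lam $ i $ l"
  shows "strictly_convex_on UNIV (\<lambda>y. \<Sum>i\<in>UNIV. \<L> i y (lam $ i) (mu $ i))"
proof -
  have "convex_on UNIV (\<lambda>y. \<Sum>i\<in>UNIV.
      (\<Sum>l\<in>Cin i. lam $ i $ l * g i l y) + (\<Sum>j\<in>Ceq i. mu $ i $ j * h i j y))"
    by (intro convex_on_sum_fun multiplier_part_convex assms) auto
  from strictly_convex_on_add[OF sum_strictly_convex this]
  show ?thesis by (simp add: lagrangian_def sum.distrib add.assoc)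
qed

text \<open>Weak duality: slackness turns \<open>f i y\<close> into the Lagrangian at
  \<open>y\<close>, the tangent inequality leads to the Lagrangian at \<open>ystar\<close>, and
  feasibility bounds that by \<open>f i ystar\<close>. Only the sum of the gradients vanishes, since
  the single ones are balanced by the controllers. Equal optimal values and strict convexity then
  give \<open>y = ystar\<close>.\<close>

lemma KKT_imp_eq_ystar:
  assumes y: "feasible g h Cin Ceq y" and lam: "\<And>i l. l \<in> Cin i \<Longrightarrow> 0 \<le> lam $ i $ l"
    and slack: "\<And>i l. l \<in> Cin i \<Longrightarrow> lam $ i $ l * g i l y = 0"
    and stationary: "(\<Sum>i\<in>UNIV. \<D> i (lam $ i) (mu $ i) y) = 0"
  shows "y = ystar"
proof (rule strictly_convex_on_minimizer_unique[OF sum_strictly_convex])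
  have "(\<Sum>i\<in>UNIV. f i y) = (\<Sum>i\<in>UNIV. f i y + \<D> i (lam $ i) (mu $ i) y \<bullet> (ystar - y))"
    using stationary by (simp add: sum.distrib flip: inner_sum_left)
  also have "\<dots> \<le> (\<Sum>i\<in>UNIV. f i ystar)"
  proof (rule sum_mono)
    fix i
    show "f i y + \<D> i (lam $ i) (mu $ i) y \<bullet> (ystar - y) \<le> f i ystar"
      using lagrangian_above_tangent[of i "lam $ i" y "mu $ i" ystar] lam
        lagrangian_le_objective[OF feasible_ystar, of i "lam $ i" "mu $ i"]
        lagrangian_eq_objective[OF y, of i "lam $ i" "mu $ i"] slack
      by simp
  qed
  finally show eq: "(\<Sum>i\<in>UNIV. f i y) = (\<Sum>i\<in>UNIV. f i ystar)" using ystar_le[OF y] by simp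
  have "feasible g h Cin Ceq ((1 / 2) *\<^sub>R y + (1 / 2) *\<^sub>R ystar)"
    unfolding feasible_def
  proof (intro conjI allI ballI)
    fix i l assume l: "l \<in> Cin i"
    have "g i l ((1 / 2) *\<^sub>R y + (1 / 2) *\<^sub>R ystar) \<le> 1 / 2 * g i l y + 1 / 2 * g i l ystar"
      using convex_onD[OF g_convex[OF l], of "1 / 2" y ystar] by simp
    moreover have "g i l y \<le> 0" "g i l ystar \<le> 0" using y feasible_ystar l by (auto simp: feasible_def)
    ultimately show "g i l ((1 / 2) *\<^sub>R y + (1 / 2) *\<^sub>R ystar) \<le> 0" by linarith
  next
    fix i j assume j: "j \<in> Ceq i"
    have "h i j y = 0" "h i j ystar = 0" using y feasible_ystar j by (auto simp: feasible_def)
    then show "h i j ((1 / 2) *\<^sub>R y + (1 / 2) *\<^sub>R ystar) = 0"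
      by (simp add: h_affine[OF j] inner_add_right)
  qed
  then show "(\<Sum>i\<in>UNIV. f i y) \<le> (\<Sum>i\<in>UNIV. f i ((1 / 2) *\<^sub>R y + (1 / 2) *\<^sub>R ystar))"
    unfolding eq by (rule ystar_le)
qed auto

text \<open>Controllers at rest force \<zeta> to vanish and hence consensus. The remaining
  equations, with stationarity summed over the agents, are the KKT conditions at the common
  value.\<close>

lemma equilibrium_data:
  assumes "equilibrium (closed_loop f g h Cin Ceq \<alpha> \<beta> E) (state_space Cin Ceq) (x, lam, mu, z)"
  shows "x = (\<chi> i. ystar)" and "\<And>i l. l \<in> Cin i \<Longrightarrow> 0 \<le> lam $ i $ l"
    and "\<And>i l. l \<in> Cin i \<Longrightarrow> lam $ i $ l * g i l ystar = 0"
    and "\<And>i. \<D> i (lam $ i) (mu $ i) ystar = - (\<Sum>k\<in>UNIV. E $ i $ k *\<^sub>R z $ k)"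
proof -
  have F: "closed_loop f g h Cin Ceq \<alpha> \<beta> E (x, lam, mu, z) = 0"
    and S: "(x, lam, mu, z) \<in> state_space Cin Ceq"
    using assms by (auto simp: equilibrium_def)
  show lam: "\<And>i l. l \<in> Cin i \<Longrightarrow> 0 \<le> lam $ i $ l" using S by (simp add: state_space_def)
  have "\<beta> k *\<^sub>R coupling E x $ k = 0" for k
    using F unfolding closed_loop_eq zero_prod_def by (simp add: vec_eq_iff)
  then have zeta: "coupling E x = 0" using beta_pos by (simp add: vec_eq_iff less_imp_neq[symmetric])
  then obtain y where y: "x = (\<chi> i. y)" using coupling_zero_imp_consensus[OF ker_E] by blast
  have e: "(\<chi> i. - \<alpha> i *\<^sub>R (\<D> i (lam $ i) (mu $ i) y + (\<Sum>k\<in>UNIV. E $ i $ k *\<^sub>R z $ k))) = 0"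
    using F zeta unfolding closed_loop_eq zero_prod_def by (simp add: y)
  have e0: "- \<alpha> i *\<^sub>R (\<D> i (lam $ i) (mu $ i) y + (\<Sum>k\<in>UNIV. E $ i $ k *\<^sub>R z $ k)) = 0" for i
    using arg_cong[OF e, of "\<lambda>v. v $ i"] by (simp only: vec_lambda_beta zero_index)
  have grad: "\<D> i (lam $ i) (mu $ i) y = - (\<Sum>k\<in>UNIV. E $ i $ k *\<^sub>R z $ k)" for i
    using e0[of i] alpha_pos[of i] by (simp add: eq_neg_iff_add_eq_0)
  have g: "(if lam $ i $ l = 0 \<and> g i l y < 0 then 0 else g i l y) = 0" if "l \<in> Cin i" for i l
  proof -
    have e: "(\<chi> i. \<chi> l. if l \<notin> Cin i \<or> lam $ i $ l = 0 \<and> g i l y < 0 then 0 else g i l y) = 0"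
      using F unfolding closed_loop_eq zero_prod_def by (simp add: y cong: if_cong)
    have "(if l \<notin> Cin i \<or> lam $ i $ l = 0 \<and> g i l y < 0 then 0 else g i l y) = 0"
      using arg_cong[OF e, of "\<lambda>v. v $ i $ l"] by (simp only: vec_lambda_beta zero_index)
    then show ?thesis using that by simp
  qed
  \<comment> \<open>The switching rule rests in two cases: the constraint is active, or it is
    inactive with zero multiplier.\<close>
  have slack: "lam $ i $ l * g i l y = 0" if "l \<in> Cin i" for i l
    using g[OF that] by (auto split: if_splits)
  have e: "(\<chi> i. \<chi> j. if j \<in> Ceq i then h i j y else 0) = 0"
    using F unfolding closed_loop_eq zero_prod_def by (simp add: y cong: if_cong)
  have "(if j \<in> Ceq i then h i j y else 0) = 0" for i j
    using arg_cong[OF e, of "\<lambda>v. v $ i $ j"] by (simp only: vec_lambda_beta zero_index)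
  then have h: "h i j y = 0" if "j \<in> Ceq i" for i j using that by metis
  have feas: "feasible g h Cin Ceq y"
    unfolding feasible_def using h g by (metis less_imp_le order_refl)
  have "(\<Sum>i\<in>UNIV. \<D> i (lam $ i) (mu $ i) y) = 0"
  proof -
    \<comment> \<open>Testing with the consensus vector of \<open>v\<close> and passing to the
      adjoint leaves \<open>coupling E\<close> of a consensus vector, which is zero; the forces from
      \<open>z\<close> thus cancel in the sum.\<close>
    have "(\<Sum>i\<in>UNIV. \<D> i (lam $ i) (mu $ i) y) \<bullet> v = 0" for v
      using coupling_adjoint[of "\<chi> i. v" E z] coupling_consensus[OF ker_E, of v]
      by (simp add: grad sum_negf inner_commute[of _ v] inner_sum_right)
    then show ?thesis using inner_eq_zero_iff by blast
  qed
  then have "y = ystar" by (intro KKT_imp_eq_ystar[OF feas lam slack])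
  then show "x = (\<chi> i. ystar)"
    and "\<And>i l. l \<in> Cin i \<Longrightarrow> lam $ i $ l * g i l ystar = 0"
    and "\<And>i. \<D> i (lam $ i) (mu $ i) ystar = - (\<Sum>k\<in>UNIV. E $ i $ k *\<^sub>R z $ k)"
    using y slack grad by auto
qed

text \<open>Unowned labels become the inactive constraint \<open>-1 \<le> 0\<close>, so that complementary slackness
  forces their multipliers to vanish.\<close>

lemma equilibrium_exists:
  "\<exists>e. equilibrium (closed_loop f g h Cin Ceq \<alpha> \<beta> E) (state_space Cin Ceq) e"
proof -
  define G :: "real^'n \<Rightarrow> real^('a \<times> 'l)" where
    "G y = (\<chi> p. if snd p \<in> Cin (fst p) then g (fst p) (snd p) y else -1)" for y
  define H :: "real^'n \<Rightarrow> real^('a \<times> 'm)" where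
    "H y = (\<chi> p. if snd p \<in> Ceq (fst p) then h (fst p) (snd p) y else 0)" for y
  obtain y0 where y0: "\<And>i l. l \<in> Cin i \<Longrightarrow> g i l y0 < 0" "\<And>i j. j \<in> Ceq i \<Longrightarrow> h i j y0 = 0"
    using slater unfolding slater_def by blast
  have feasible_iff: "feasible g h Cin Ceq y \<longleftrightarrow> (\<forall>p. G y $ p \<le> 0) \<and> H y = 0" for y
    by (force simp: feasible_def G_def H_def vec_eq_iff)
  obtain lam mu where lam: "\<And>p. 0 \<le> lam $ p"
    and min: "\<And>y. (\<Sum>i\<in>UNIV. f i ystar) \<le> (\<Sum>i\<in>UNIV. f i y) + lam \<bullet> G y + mu \<bullet> H y"
  proof (rule slater_multipliers[of "\<lambda>y. \<Sum>i\<in>UNIV. f i y" G H y0 ystar])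
    show "convex_on UNIV (\<lambda>y. \<Sum>i\<in>UNIV. f i y)" by (intro convex_on_sum_fun f_convex) auto
    show "convex_on UNIV (\<lambda>y. G y $ p)" for p
      by (cases "snd p \<in> Cin (fst p)") (simp_all add: G_def g_convex convex_on_const)
    show "H ((1 - t) *\<^sub>R x + t *\<^sub>R y) = (1 - t) *\<^sub>R H x + t *\<^sub>R H y" for x y t
      by (auto simp: H_def vec_eq_iff h_affine inner_add_right algebra_simps)
    show "G y0 $ p < 0" for p using y0(1) by (simp add: G_def)
    show "H y0 = 0" using y0(2) by (simp add: H_def vec_eq_iff)
    show "(\<Sum>i\<in>UNIV. f i ystar) \<le> (\<Sum>i\<in>UNIV. f i y)" if "\<And>p. G y $ p \<le> 0" "H y = 0" for y
      using that by (intro ystar_le) (simp add: feasible_iff)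
  qed blast
  have star: "G ystar $ p \<le> 0" "H ystar = 0" for p using feasible_ystar feasible_iff[of ystar] by blast+
  \<comment> \<open>At \<open>ystar\<close> the multiplier inequality says that a sum of nonpositive
    terms is nonnegative, so each term vanishes.\<close>
  have slack: "lam $ p * G ystar $ p = 0" for p
  proof -
    have nonneg: "0 \<le> - (lam $ p * G ystar $ p)" for p
      using lam star(1) by (simp add: mult_nonneg_nonpos)
    have "(\<Sum>p\<in>UNIV. - (lam $ p * G ystar $ p)) \<le> 0"
      using min[of ystar] star(2) by (simp add: inner_vec_def sum_negf)
    then have "(\<Sum>p\<in>UNIV. - (lam $ p * G ystar $ p)) = 0"
      using sum_nonneg[of UNIV "\<lambda>p. - (lam $ p * G ystar $ p)"] nonneg by fastforce
    then have "\<forall>p\<in>UNIV. - (lam $ p * G ystar $ p) = 0"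
      by (simp only: sum_nonneg_eq_0_iff[OF finite nonneg])
    then show ?thesis using neg_equal_0_iff_equal by blast
  qed
  define lam' :: "real^'l^'a" where "lam' = (\<chi> i l. lam $ (i, l))"
  \<comment> \<open>Unowned components of \<open>H\<close> are zero and leave \<open>mu\<close>
    arbitrary there, so they are reset by hand; for \<open>lam\<close> slackness against the value
    \<open>-1\<close> does this.\<close>
  define mu' :: "real^'m^'a" where "mu' = (\<chi> i j. if j \<in> Ceq i then mu $ (i, j) else 0)"
  have unowned: "lam' $ i $ l = 0" if "l \<notin> Cin i" for i l
    using slack[of "(i, l)"] that by (simp add: lam'_def G_def)
  have slack': "lam' $ i $ l * g i l ystar = 0" if "l \<in> Cin i" for i l
    using slack[of "(i, l)"] that by (simp add: lam'_def G_def)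
  have sum_eq: "(\<Sum>i\<in>UNIV. \<L> i y (lam' $ i) (mu' $ i)) = (\<Sum>i\<in>UNIV. f i y) + lam \<bullet> G y + mu \<bullet> H y" for y
  proof -
    have "lam \<bullet> G y = (\<Sum>p\<in>UNIV \<times> UNIV. lam $ p * G y $ p)" by (simp add: inner_vec_def)
    also have "\<dots> = (\<Sum>i\<in>UNIV. \<Sum>l\<in>UNIV. lam $ (i, l) * G y $ (i, l))"
      unfolding sum.cartesian_product by (simp add: case_prod_unfold)
    also have "\<dots> = (\<Sum>i\<in>UNIV. \<Sum>l\<in>Cin i. lam' $ i $ l * g i l y)"
      using unowned
      by (intro sum.cong refl sum.mono_neutral_cong_right) (auto simp: lam'_def G_def)
    finally have 1: "lam \<bullet> G y = \<dots>" .
    have "mu \<bullet> H y = (\<Sum>p\<in>UNIV \<times> UNIV. mu $ p * H y $ p)" by (simp add: inner_vec_def)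
    also have "\<dots> = (\<Sum>i\<in>UNIV. \<Sum>j\<in>UNIV. mu $ (i, j) * H y $ (i, j))"
      unfolding sum.cartesian_product by (simp add: case_prod_unfold)
    also have "\<dots> = (\<Sum>i\<in>UNIV. \<Sum>j\<in>Ceq i. mu' $ i $ j * h i j y)"
      by (intro sum.cong refl sum.mono_neutral_cong_right) (auto simp: mu'_def H_def)
    finally show ?thesis using 1 by (simp add: lagrangian_def sum.distrib)
  qed
  \<comment> \<open>By the multiplier inequality \<open>ystar\<close> is a global minimizer of the
    summed Lagrangian.\<close>
  have "(\<Sum>i\<in>UNIV. \<D> i (lam' $ i) (mu' $ i) ystar) = 0"
  proof (rule gderiv_eq_zero_at_min)
    show "GDERIV (\<lambda>y. \<Sum>i\<in>UNIV. \<L> i y (lam' $ i) (mu' $ i)) ystar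
        :> (\<Sum>i\<in>UNIV. \<D> i (lam' $ i) (mu' $ i) ystar)"
      unfolding gderiv_def inner_sum_right
      using lagrangian_gderiv unfolding gderiv_def by (intro has_derivative_sum) blast
    fix y
    have "(\<Sum>i\<in>UNIV. \<L> i ystar (lam' $ i) (mu' $ i)) = (\<Sum>i\<in>UNIV. f i ystar)"
      using slack' by (intro sum.cong refl lagrangian_eq_objective feasible_ystar)
    then show "(\<Sum>i\<in>UNIV. \<L> i ystar (lam' $ i) (mu' $ i)) \<le> (\<Sum>i\<in>UNIV. \<L> i y (lam' $ i) (mu' $ i))"
      using min[of y] by (simp add: sum_eq)
  qed
  \<comment> \<open>Forces with zero sum can be generated by the controllers, so a suitable
    \<open>z\<close> balances each agent's gradient separately.\<close>
  then have "(\<Sum>i\<in>UNIV. - \<D> i (lam' $ i) (mu' $ i) ystar) = 0" by (simp add: sum_negf)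
  then obtain z :: "real^'n^'k" where
    z: "\<And>i. (\<Sum>k\<in>UNIV. E $ i $ k *\<^sub>R z $ k) = - \<D> i (lam' $ i) (mu' $ i) ystar"
    using coupling_range[OF ker_E] by blast
  have "closed_loop f g h Cin Ceq \<alpha> \<beta> E (\<chi> i. ystar, lam', mu', z) = 0"
    unfolding closed_loop_eq zero_prod_def coupling_consensus[OF ker_E]
    using z slack' feasible_ystar by (force simp: vec_eq_iff feasible_def)
  moreover have "(\<chi> i. ystar, lam', mu', z) \<in> state_space Cin Ceq"
    using lam unowned by (auto simp: state_space_def lam'_def mu'_def)
  ultimately show ?thesis unfolding equilibrium_def by blast
qed

end

subsection \<open>Dissipation\<close>

context distributed_optimization
begin

text \<open>The weights \<open>1 / \<alpha> i\<close> and \<open>1 / \<beta> k\<close> cancel the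
  gains of the dynamics, so that agents and controllers enter the energy balance on the same
  scale.\<close>

definition energy :: "('n, 'a, 'l, 'm, 'k) state \<Rightarrow> ('n, 'a, 'l, 'm, 'k) state \<Rightarrow> real" where
  "energy p q = (\<Sum>i\<in>UNIV. (fst p $ i \<bullet> fst q $ i) / \<alpha> i) + fst (snd p) \<bullet> fst (snd q)
     + fst (snd (snd p)) \<bullet> fst (snd (snd q))
     + (\<Sum>k\<in>UNIV. (snd (snd (snd p)) $ k \<bullet> snd (snd (snd q)) $ k) / \<beta> k)"

lemma energy_sym: "energy p q = energy q p"
  by (simp add: energy_def inner_commute)

lemma energy_bounded_bilinear: "bounded_bilinear energy"
proof -
  have lin: "linear (\<lambda>q. energy p q)" for p
    by (rule linearI)
      (simp_all add: energy_def inner_add_right add_divide_distrib sum.distrib sum_distrib_left algebra_simps)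
  then have "linear (\<lambda>p. energy p q)" for q by (subst energy_sym)
  with lin show ?thesis by (simp add: bilinear_def flip: bilinear_conv_bounded_bilinear)
qed

lemma energy_coercive: "\<exists>\<kappa>>0. \<forall>p. \<kappa> * (norm p)\<^sup>2 \<le> energy p p"
proof -
  \<comment> \<open>All weights of the quadratic form; \<open>1\<close> is the weight of both
    multiplier blocks.\<close>
  define A where "A = insert 1 (range (\<lambda>i. 1 / \<alpha> i) \<union> range (\<lambda>k. 1 / \<beta> k))"
  define \<kappa> where "\<kappa> = Min A"
  have A: "finite A" "A \<noteq> {}" by (auto simp: A_def)
  have "0 < \<kappa>" unfolding \<kappa>_def using A alpha_pos beta_pos by (subst Min_gr_iff) (auto simp: A_def)
  have \<kappa>: "\<kappa> \<le> 1 / \<alpha> i" "\<kappa> \<le> 1" "\<kappa> \<le> 1 / \<beta> k" for i k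
    unfolding \<kappa>_def by (rule Min_le[OF A(1)], simp add: A_def)+
  have "\<kappa> * (norm p)\<^sup>2 \<le> energy p p" for p :: "('n, 'a, 'l, 'm, 'k) state"
  proof -
    obtain x lam mu z where p: "p = (x, lam, mu, z)" by (cases p) auto
    have "\<kappa> * (norm p)\<^sup>2 = \<kappa> * (x \<bullet> x) + \<kappa> * (lam \<bullet> lam) + \<kappa> * (mu \<bullet> mu) + \<kappa> * (z \<bullet> z)"
      by (simp add: p power2_norm_eq_inner algebra_simps)
    also have "\<kappa> * (x \<bullet> x) \<le> (\<Sum>i\<in>UNIV. (x $ i \<bullet> x $ i) / \<alpha> i)"
      unfolding inner_vec_def[of x x] sum_distrib_left
      using mult_right_mono[OF \<kappa>(1) inner_ge_zero] by (intro sum_mono) (simp add: mult.commute)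
    also have "\<kappa> * (lam \<bullet> lam) \<le> lam \<bullet> lam" using mult_right_mono[OF \<kappa>(2) inner_ge_zero[of lam]] by simp
    also have "\<kappa> * (mu \<bullet> mu) \<le> mu \<bullet> mu" using mult_right_mono[OF \<kappa>(2) inner_ge_zero[of mu]] by simp
    also have "\<kappa> * (z \<bullet> z) \<le> (\<Sum>k\<in>UNIV. (z $ k \<bullet> z $ k) / \<beta> k)"
      unfolding inner_vec_def[of z z] sum_distrib_left
      using mult_right_mono[OF \<kappa>(3) inner_ge_zero] by (intro sum_mono) (simp add: mult.commute)
    finally show ?thesis by (simp add: p energy_def)
  qed
  with \<open>0 < \<kappa>\<close> show ?thesis by blast
qed

definition dissipation_rate :: "real^'l^'a \<Rightarrow> real^'m^'a \<Rightarrow> real^'n^'k \<Rightarrow> real^'n^'a \<Rightarrow> real" where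
  "dissipation_rate lam mu z x = (\<Sum>i\<in>UNIV. \<L> i (x $ i) (lam $ i) (mu $ i) - f i ystar)
     + (\<Sum>k\<in>UNIV. coupling E x $ k \<bullet> z $ k) + (\<Sum>k\<in>UNIV. \<beta> k * (norm (coupling E x $ k))\<^sup>2)"

lemma dissipation_rate_continuous: "continuous_on UNIV (dissipation_rate lam mu z)"
proof -
  have L: "continuous_on UNIV (\<lambda>y. \<L> i y lam mu)" for i lam mu
    using lagrangian_gderiv has_derivative_continuous unfolding gderiv_def
    by (metis continuous_at_imp_continuous_on)
  have x: "continuous_on UNIV (\<lambda>x :: real^'n^'a. x $ i)" for i
    by (intro continuous_intros)
  have c: "continuous_on UNIV (\<lambda>x :: real^'n^'a. coupling E x $ k)" for k
    unfolding coupling_def vec_lambda_beta by (intro continuous_intros)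
  have L': "continuous_on UNIV (\<lambda>x :: real^'n^'a. \<L> i (x $ i) lam mu)" for i lam mu
    by (rule continuous_on_compose2[OF L x]) auto
  show ?thesis
    unfolding dissipation_rate_def
    by (intro continuous_on_add continuous_on_sum continuous_on_diff continuous_on_inner
        continuous_on_mult continuous_on_power continuous_on_norm continuous_on_const c L')
qed

section \<open>Decay of the energy relative to a fixed equilibrium\<close>

context
  fixes lamb :: "real^'l^'a" and mub :: "real^'m^'a" and zb :: "real^'n^'k"
  assumes lamb: "\<And>i l. l \<in> Cin i \<Longrightarrow> 0 \<le> lamb $ i $ l"
    and slack: "\<And>i l. l \<in> Cin i \<Longrightarrow> lamb $ i $ l * g i l ystar = 0"
    and stationary: "\<And>i. \<D> i (lamb $ i) (mub $ i) ystar = - (\<Sum>k\<in>UNIV. E $ i $ k *\<^sub>R zb $ k)"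
begin

text \<open>The first two sums of the rate are together nonnegative: the tangents of the Lagrangians
  at \<open>ystar\<close> have slopes given by \<open>zb\<close>, and by adjointness these add up to
  minus the pairing of \<zeta> with \<open>zb\<close>.\<close>

lemma dissipation_rate_ge:
  "(\<Sum>k\<in>UNIV. \<beta> k * (norm (coupling E x $ k))\<^sup>2) \<le> dissipation_rate lamb mub zb x"
proof -
  have "(\<Sum>i\<in>UNIV. (x - (\<chi> i. ystar)) $ i \<bullet> (\<Sum>k\<in>UNIV. E $ i $ k *\<^sub>R zb $ k))
      = (\<Sum>k\<in>UNIV. coupling E x $ k \<bullet> zb $ k)"
    by (simp only: coupling_adjoint coupling_diff coupling_consensus[OF ker_E] diff_zero)
  then have "- (\<Sum>k\<in>UNIV. coupling E x $ k \<bullet> zb $ k)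
      = (\<Sum>i\<in>UNIV. - (\<Sum>k\<in>UNIV. E $ i $ k *\<^sub>R zb $ k) \<bullet> (x $ i - ystar))"
    by (simp add: sum_negf inner_commute)
  also have "\<dots> = (\<Sum>i\<in>UNIV. \<D> i (lamb $ i) (mub $ i) ystar \<bullet> (x $ i - ystar))"
    by (simp only: stationary)
  also have "\<dots> \<le> (\<Sum>i\<in>UNIV. \<L> i (x $ i) (lamb $ i) (mub $ i) - f i ystar)"
  proof (rule sum_mono)
    fix i
    show "\<D> i (lamb $ i) (mub $ i) ystar \<bullet> (x $ i - ystar) \<le> \<L> i (x $ i) (lamb $ i) (mub $ i) - f i ystar"
      using lagrangian_above_tangent[of i "lamb $ i" ystar "mub $ i" "x $ i", OF lamb]
        lagrangian_eq_objective[OF feasible_ystar, of i "lamb $ i" "mub $ i", OF slack] by simp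
  qed
  finally show ?thesis by (simp add: dissipation_rate_def)
qed

lemma dissipation_rate_nonneg: "0 \<le> dissipation_rate lamb mub zb x"
proof -
  have "0 \<le> (\<Sum>k\<in>UNIV. \<beta> k * (norm (coupling E x $ k))\<^sup>2)"
    using beta_pos by (intro sum_nonneg) (simp add: less_imp_le)
  then show ?thesis using dissipation_rate_ge[of x] by linarith
qed

lemma dissipation_rate_consensus:
  "dissipation_rate lamb mub zb (\<chi> i. y)
     = (\<Sum>i\<in>UNIV. \<L> i y (lamb $ i) (mub $ i)) - (\<Sum>i\<in>UNIV. \<L> i ystar (lamb $ i) (mub $ i))"
proof -
  have "\<L> i ystar (lamb $ i) (mub $ i) = f i ystar" for i
    by (intro lagrangian_eq_objective feasible_ystar slack)
  then show ?thesis
    by (simp add: dissipation_rate_def coupling_consensus[OF ker_E] sum_subtractf)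
qed

lemma dissipation_rate_zero:
  assumes "dissipation_rate lamb mub zb x = 0"
  shows "x = (\<chi> i. ystar)"
proof -
  have nonneg: "0 \<le> \<beta> k * (norm (coupling E x $ k))\<^sup>2" for k
    using beta_pos[of k] by simp
  then have "0 \<le> (\<Sum>k\<in>UNIV. \<beta> k * (norm (coupling E x $ k))\<^sup>2)" by (intro sum_nonneg)
  then have "(\<Sum>k\<in>UNIV. \<beta> k * (norm (coupling E x $ k))\<^sup>2) = 0"
    using dissipation_rate_ge[of x] assms by linarith
  then have "\<forall>k\<in>UNIV. \<beta> k * (norm (coupling E x $ k))\<^sup>2 = 0"
    by (simp only: sum_nonneg_eq_0_iff[OF finite nonneg])
  then have "\<beta> k * (norm (coupling E x $ k))\<^sup>2 = 0" for k by blast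
  then have "coupling E x $ k = 0" for k
    using beta_pos[of k] by (metis mult_eq_0_iff less_irrefl norm_eq_zero power_eq_0_iff)
  then have "coupling E x = 0" by (simp add: vec_eq_iff)
  then obtain y where y: "x = (\<chi> i. y)" using coupling_zero_imp_consensus[OF ker_E] by blast
  have "y = ystar"
  proof (rule strictly_convex_on_minimizer_unique[OF sum_lagrangian_strictly_convex[OF lamb]])
    show "(\<Sum>i\<in>UNIV. \<L> i y (lamb $ i) (mub $ i)) = (\<Sum>i\<in>UNIV. \<L> i ystar (lamb $ i) (mub $ i))"
      using assms dissipation_rate_consensus[of y] by (simp add: y)
    \<comment> \<open>On consensus vectors the rate is the gap of the summed Lagrangian to its value
      at \<open>ystar\<close>; nonnegativity at the midpoint is the required minimality.\<close>
    then show "(\<Sum>i\<in>UNIV. \<L> i y (lamb $ i) (mub $ i))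
        \<le> (\<Sum>i\<in>UNIV. \<L> i ((1 / 2) *\<^sub>R y + (1 / 2) *\<^sub>R ystar) (lamb $ i) (mub $ i))"
      using dissipation_rate_consensus[of "(1 / 2) *\<^sub>R y + (1 / 2) *\<^sub>R ystar"]
        dissipation_rate_nonneg[of "\<chi> i. (1 / 2) *\<^sub>R y + (1 / 2) *\<^sub>R ystar"] by linarith
  qed auto
  then show ?thesis using y by simp
qed

text \<open>A saddle-point estimate: convexity is applied at the current state with the current
  multipliers, and linearity in the multipliers then exchanges them for those of the
  equilibrium.\<close>

lemma energy_dissipation:
  assumes p: "p \<in> state_space Cin Ceq"
  shows "energy (p - (\<chi> i. ystar, lamb, mub, zb)) (closed_loop f g h Cin Ceq \<alpha> \<beta> E p)
    \<le> - dissipation_rate lamb mub zb (agent_outputs p)"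
proof -
  obtain x lam mu z where p_eq: "p = (x, lam, mu, z)" by (cases p) auto
  have lam: "0 \<le> lam $ i $ l" if "l \<in> Cin i" for i l
    using p that by (simp add: p_eq state_space_def)
  have \<alpha>_nonzero: "\<alpha> i \<noteq> 0" for i using alpha_pos[of i] by simp
  define d where "d k = z $ k + \<beta> k *\<^sub>R coupling E x $ k" for k
  define dlam where "dlam i l = (if l \<notin> Cin i \<or> lam $ i $ l = 0 \<and> g i l (x $ i) < 0 then 0 else g i l (x $ i))" for i l
  define dmu where "dmu i j = (if j \<in> Ceq i then h i j (x $ i) else 0)" for i j
  have "energy (p - (\<chi> i. ystar, lamb, mub, zb)) (closed_loop f g h Cin Ceq \<alpha> \<beta> E p)
     = (\<Sum>i\<in>UNIV. ((x $ i - ystar) \<bullet> (- \<alpha> i *\<^sub>R (\<D> i (lam $ i) (mu $ i) (x $ i)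
          + (\<Sum>k\<in>UNIV. E $ i $ k *\<^sub>R d k)))) / \<alpha> i)
       + (lam - lamb) \<bullet> (\<chi> i l. dlam i l) + (mu - mub) \<bullet> (\<chi> i j. dmu i j)
       + (\<Sum>k\<in>UNIV. ((z $ k - zb $ k) \<bullet> (\<beta> k *\<^sub>R coupling E x $ k)) / \<beta> k)"
    unfolding p_eq closed_loop_eq energy_def d_def dlam_def dmu_def by simp
  also have "(\<Sum>i\<in>UNIV. ((x $ i - ystar) \<bullet> (- \<alpha> i *\<^sub>R (\<D> i (lam $ i) (mu $ i) (x $ i)
          + (\<Sum>k\<in>UNIV. E $ i $ k *\<^sub>R d k)))) / \<alpha> i)
      = (\<Sum>i\<in>UNIV. (x $ i - ystar) \<bullet> - \<D> i (lam $ i) (mu $ i) (x $ i))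
        - (\<Sum>i\<in>UNIV. (x $ i - ystar) \<bullet> (\<Sum>k\<in>UNIV. E $ i $ k *\<^sub>R d k))"
    unfolding sum_subtractf[symmetric]
    by (intro sum.cong refl) (simp add: inner_add_right \<alpha>_nonzero)
  also have "(\<Sum>i\<in>UNIV. (x $ i - ystar) \<bullet> (\<Sum>k\<in>UNIV. E $ i $ k *\<^sub>R d k))
      = (\<Sum>k\<in>UNIV. coupling E x $ k \<bullet> d k)"
    using coupling_adjoint[of "x - (\<chi> i. ystar)" E "\<chi> k. d k"]
    by (simp add: coupling_diff coupling_consensus[OF ker_E])
  also have "(\<Sum>k\<in>UNIV. ((z $ k - zb $ k) \<bullet> (\<beta> k *\<^sub>R coupling E x $ k)) / \<beta> k)
      = (\<Sum>k\<in>UNIV. (z $ k - zb $ k) \<bullet> coupling E x $ k)"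
    using beta_pos by (simp add: less_imp_neq[symmetric])
  also have "(lam - lamb) \<bullet> (\<chi> i l. dlam i l)
      \<le> (\<Sum>i\<in>UNIV. \<Sum>l\<in>Cin i. (lam $ i $ l - lamb $ i $ l) * g i l (x $ i))"
  proof -
    have "(lam - lamb) \<bullet> (\<chi> i l. dlam i l) = (\<Sum>i\<in>UNIV. \<Sum>l\<in>UNIV. (lam $ i $ l - lamb $ i $ l) * dlam i l)"
      by (simp add: inner_vec_def)
    also have "\<dots> = (\<Sum>i\<in>UNIV. \<Sum>l\<in>Cin i. (lam $ i $ l - lamb $ i $ l) * dlam i l)"
      by (intro sum.cong refl sum.mono_neutral_right) (auto simp: dlam_def)
    also have "\<dots> \<le> (\<Sum>i\<in>UNIV. \<Sum>l\<in>Cin i. (lam $ i $ l - lamb $ i $ l) * g i l (x $ i))"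
    proof (intro sum_mono)
      fix i l assume l: "l \<in> Cin i"
      show "(lam $ i $ l - lamb $ i $ l) * dlam i l \<le> (lam $ i $ l - lamb $ i $ l) * g i l (x $ i)"
      proof (cases "lam $ i $ l = 0 \<and> g i l (x $ i) < 0")
        \<comment> \<open>With the switch active the multiplier is zero, and freezing it replaces
          \<open>- lamb $ i $ l * g i l (x $ i)\<close>, which is nonnegative, by zero.\<close>
        case True
        then show ?thesis using lamb[OF l] by (simp add: dlam_def mult_nonneg_nonpos)
      next
        case False
        then have "dlam i l = g i l (x $ i)" using l unfolding dlam_def by meson
        then show ?thesis by simp
      qed
    qed
    finally show ?thesis .
  qed
  also have "(mu - mub) \<bullet> (\<chi> i j. dmu i j)
      = (\<Sum>i\<in>UNIV. \<Sum>j\<in>Ceq i. (mu $ i $ j - mub $ i $ j) * h i j (x $ i))"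
  proof -
    have "(mu - mub) \<bullet> (\<chi> i j. dmu i j) = (\<Sum>i\<in>UNIV. \<Sum>j\<in>UNIV. (mu $ i $ j - mub $ i $ j) * dmu i j)"
      by (simp add: inner_vec_def)
    also have "\<dots> = (\<Sum>i\<in>UNIV. \<Sum>j\<in>Ceq i. (mu $ i $ j - mub $ i $ j) * h i j (x $ i))"
      by (intro sum.cong refl sum.mono_neutral_cong_right) (auto simp: dmu_def)
    finally show ?thesis .
  qed
  \<comment> \<open>Tangent at \<open>x $ i\<close>, evaluated at \<open>ystar\<close>, where
    feasibility bounds the Lagrangian by the objective.\<close>
  also have "(\<Sum>i\<in>UNIV. (x $ i - ystar) \<bullet> - \<D> i (lam $ i) (mu $ i) (x $ i))
      \<le> (\<Sum>i\<in>UNIV. f i ystar - \<L> i (x $ i) (lam $ i) (mu $ i))"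
  proof (rule sum_mono)
    fix i
    show "(x $ i - ystar) \<bullet> - \<D> i (lam $ i) (mu $ i) (x $ i) \<le> f i ystar - \<L> i (x $ i) (lam $ i) (mu $ i)"
      using lagrangian_above_tangent[of i "lam $ i" "x $ i" "mu $ i" ystar, OF lam]
        lagrangian_le_objective[OF feasible_ystar, of i "lam $ i" "mu $ i", OF lam]
      by (simp add: inner_commute inner_diff_left inner_diff_right)
  qed
  finally have "energy (p - (\<chi> i. ystar, lamb, mub, zb)) (closed_loop f g h Cin Ceq \<alpha> \<beta> E p)
    \<le> (\<Sum>i\<in>UNIV. f i ystar - \<L> i (x $ i) (lam $ i) (mu $ i)) - (\<Sum>k\<in>UNIV. coupling E x $ k \<bullet> d k)
      + (\<Sum>i\<in>UNIV. \<Sum>l\<in>Cin i. (lam $ i $ l - lamb $ i $ l) * g i l (x $ i))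
      + (\<Sum>i\<in>UNIV. \<Sum>j\<in>Ceq i. (mu $ i $ j - mub $ i $ j) * h i j (x $ i))
      + (\<Sum>k\<in>UNIV. (z $ k - zb $ k) \<bullet> coupling E x $ k)"
    by simp
  \<comment> \<open>The integral part of the controller output, relative to \<open>zb\<close>,
    cancels against the storage of the controllers; the proportional part leaves the quadratic
    damping term.\<close>
  also have "(\<Sum>k\<in>UNIV. coupling E x $ k \<bullet> d k) = (\<Sum>k\<in>UNIV. (z $ k - zb $ k) \<bullet> coupling E x $ k)
      + ((\<Sum>k\<in>UNIV. coupling E x $ k \<bullet> zb $ k) + (\<Sum>k\<in>UNIV. \<beta> k * (norm (coupling E x $ k))\<^sup>2))"
    unfolding sum.distrib[symmetric]
    by (intro sum.cong refl)
      (simp add: d_def inner_add_right inner_diff_left inner_diff_right inner_commute power2_norm_eq_inner)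
  \<comment> \<open>Passing from the current multipliers to \<open>lamb\<close> and
    \<open>mub\<close> changes the Lagrangians by exactly the two multiplier sums above.\<close>
  also have "(\<Sum>i\<in>UNIV. f i ystar - \<L> i (x $ i) (lam $ i) (mu $ i))
      = - (\<Sum>i\<in>UNIV. \<L> i (x $ i) (lamb $ i) (mub $ i) - f i ystar)
        - ((\<Sum>i\<in>UNIV. \<Sum>l\<in>Cin i. (lam $ i $ l - lamb $ i $ l) * g i l (x $ i))
          + (\<Sum>i\<in>UNIV. \<Sum>j\<in>Ceq i. (mu $ i $ j - mub $ i $ j) * h i j (x $ i)))"
    unfolding sum.distrib[symmetric] sum_negf[symmetric] sum_subtractf[symmetric]
    by (intro sum.cong refl) (simp add: lagrangian_def left_diff_distrib sum_subtractf)
  finally show ?thesis by (simp add: dissipation_rate_def p_eq agent_outputs_def)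
qed

end

text \<open>A gradient is bounded by any Lipschitz constant of its function, and for the Lagrangian
  such a constant grows at most linearly in the multipliers, uniformly in \<open>x\<close>.\<close>

lemma norm_lagrangian_gradient_le:
  obtains C where "0 \<le> C"
    and "\<And>i lam mu x r. 0 \<le> r \<Longrightarrow> norm lam \<le> r \<Longrightarrow> norm mu \<le> r \<Longrightarrow> norm (\<D> i lam mu x) \<le> C * (1 + r)"
proof -
  obtain Cf where Cf: "\<And>i. (Cf i)-lipschitz_on UNIV (f i)" using f_lipschitz by metis
  \<comment> \<open>Lipschitz constants are available for owned labels only; the choice carries
    information just there.\<close>
  define Cg where "Cg i l = (SOME L. L-lipschitz_on UNIV (g i l))" for i l
  define Ch where "Ch i j = (SOME L. L-lipschitz_on UNIV (h i j))" for i j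
  have Cg: "(Cg i l)-lipschitz_on UNIV (g i l)" if "l \<in> Cin i" for i l
    unfolding Cg_def by (rule someI_ex[OF g_lipschitz[OF that]])
  have Ch: "(Ch i j)-lipschitz_on UNIV (h i j)" if "j \<in> Ceq i" for i j
    unfolding Ch_def by (rule someI_ex[OF h_lipschitz[OF that]])
  define C where "C = (\<Sum>i\<in>UNIV. Cf i + (\<Sum>l\<in>Cin i. Cg i l) + (\<Sum>j\<in>Ceq i. Ch i j))"
  have nonneg: "0 \<le> Cf i" "0 \<le> (\<Sum>l\<in>Cin i. Cg i l)" "0 \<le> (\<Sum>j\<in>Ceq i. Ch i j)" for i
    by (auto intro!: sum_nonneg lipschitz_on_nonneg[OF Cf] lipschitz_on_nonneg[OF Cg] lipschitz_on_nonneg[OF Ch])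
  have C: "Cf i + (\<Sum>l\<in>Cin i. Cg i l) + (\<Sum>j\<in>Ceq i. Ch i j) \<le> C" for i
    unfolding C_def
    by (rule member_le_sum[where f = "\<lambda>i. Cf i + (\<Sum>l\<in>Cin i. Cg i l) + (\<Sum>j\<in>Ceq i. Ch i j)"])
      (auto intro!: add_nonneg_nonneg nonneg)
  have "norm (\<D> i lam mu x) \<le> C * (1 + r)" if r: "0 \<le> r" "norm lam \<le> r" "norm mu \<le> r" for i lam mu x r
  proof (rule order_trans[OF norm_gderiv_le_lipschitz[OF _ lagrangian_gderiv]])
    let ?C = "Cf i + (\<Sum>l\<in>Cin i. r * Cg i l) + (\<Sum>j\<in>Ceq i. r * Ch i j)"
    have lamr: "\<bar>lam $ l\<bar> \<le> r" and mur: "\<bar>mu $ j\<bar> \<le> r" for l j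
      using component_le_norm_cart[of lam l] component_le_norm_cart[of mu j] r by linarith+
    show "(?C)-lipschitz_on UNIV (\<lambda>\<xi>. \<L> i \<xi> lam mu)"
    proof (rule lipschitz_onI)
      show "0 \<le> ?C"
        unfolding sum_distrib_left[symmetric]
        by (intro add_nonneg_nonneg mult_nonneg_nonneg nonneg r(1))
      fix x y
      have scaled: "\<bar>w * F x - w * F y\<bar> \<le> r * K * dist x y"
        if "K-lipschitz_on UNIV F" "\<bar>w\<bar> \<le> r" for w K and F :: "real^'n \<Rightarrow> real"
      proof -
        have "\<bar>w * F x - w * F y\<bar> = \<bar>w\<bar> * dist (F x) (F y)"
          unfolding dist_real_def right_diff_distrib[symmetric] abs_mult ..
        also have "\<dots> \<le> r * (K * dist x y)"
          using that r(1) by (intro mult_mono lipschitz_onD[OF that(1)]) auto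
        finally show ?thesis by (simp add: mult.assoc)
      qed
      have "\<bar>\<L> i x lam mu - \<L> i y lam mu\<bar> \<le> \<bar>f i x - f i y\<bar>
          + \<bar>\<Sum>l\<in>Cin i. lam $ l * g i l x - lam $ l * g i l y\<bar>
          + \<bar>\<Sum>j\<in>Ceq i. mu $ j * h i j x - mu $ j * h i j y\<bar>"
        unfolding lagrangian_def sum_subtractf by linarith
      also have "\<dots> \<le> Cf i * dist x y + (\<Sum>l\<in>Cin i. r * Cg i l * dist x y) + (\<Sum>j\<in>Ceq i. r * Ch i j * dist x y)"
      proof (intro add_mono order_trans[OF sum_abs] sum_mono)
        show "\<bar>f i x - f i y\<bar> \<le> Cf i * dist x y"
          using lipschitz_onD[OF Cf, of x y i] by (simp add: dist_real_def)
      qed (use lamr mur Cg Ch in \<open>auto intro!: scaled\<close>)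
      finally show "dist (\<L> i x lam mu) (\<L> i y lam mu) \<le> ?C * dist x y"
        by (simp add: dist_real_def distrib_right sum_distrib_right)
    qed
    have "?C \<le> (Cf i + (\<Sum>l\<in>Cin i. Cg i l) + (\<Sum>j\<in>Ceq i. Ch i j)) * (1 + r)"
      unfolding sum_distrib_left[symmetric] using nonneg[of i] r(1)
      by (simp add: distrib_left distrib_right mult.commute)
    also have "\<dots> \<le> C * (1 + r)" using C r(1) by (intro mult_right_mono) auto
    finally show "?C \<le> C * (1 + r)" .
  qed
  moreover have "0 \<le> C" unfolding C_def by (intro sum_nonneg add_nonneg_nonneg nonneg)
  ultimately show ?thesis using that by blast
qed

text \<open>Supplies the speed limit for the output. A bound on balls suffices, since every solution
  stays in one.\<close>

lemma agent_velocity_bounded: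
  "\<exists>M. \<forall>p\<in>state_space Cin Ceq. norm p \<le> r \<longrightarrow>
     norm (agent_outputs (closed_loop f g h Cin Ceq \<alpha> \<beta> E p)) \<le> M"
proof -
  obtain C where C: "0 \<le> C" "\<And>i lam mu x r. 0 \<le> r \<Longrightarrow> norm lam \<le> r \<Longrightarrow> norm mu \<le> r
      \<Longrightarrow> norm (\<D> i lam mu x) \<le> C * (1 + r)"
    using norm_lagrangian_gradient_le by blast
  define Cz where "Cz k = r + \<beta> k * (\<Sum>i\<in>UNIV. \<bar>E $ i $ k\<bar> * r)" for k
  have "norm (agent_outputs (closed_loop f g h Cin Ceq \<alpha> \<beta> E p))
      \<le> (\<Sum>i\<in>UNIV. \<alpha> i * (C * (1 + r) + (\<Sum>k\<in>UNIV. \<bar>E $ i $ k\<bar> * Cz k)))" if p: "norm p \<le> r" for p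
  proof -
    obtain x lam mu z where p_eq: "p = (x, lam, mu, z)" by (cases p) auto
    have "norm x \<le> r" "norm (lam, mu, z) \<le> r"
      using p norm_fst_le[of x "(lam, mu, z)"] norm_snd_le[of "(lam, mu, z)" x] by (auto simp: p_eq)
    then have "norm lam \<le> r" "norm (mu, z) \<le> r"
      using norm_fst_le[of lam "(mu, z)"] norm_snd_le[of "(mu, z)" lam] by auto
    then have "norm mu \<le> r" "norm z \<le> r"
      using norm_fst_le[of mu z] norm_snd_le[of z mu] by auto
    have comp: "norm (x $ i) \<le> r" "norm (lam $ i) \<le> r" "norm (mu $ i) \<le> r" "norm (z $ k) \<le> r" for i k
      using Finite_Cartesian_Product.norm_nth_le[of x i] Finite_Cartesian_Product.norm_nth_le[of lam i]
        Finite_Cartesian_Product.norm_nth_le[of mu i] Finite_Cartesian_Product.norm_nth_le[of z k]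
        \<open>norm x \<le> r\<close> \<open>norm lam \<le> r\<close> \<open>norm mu \<le> r\<close> \<open>norm z \<le> r\<close> by linarith+
    have "0 \<le> r" using p norm_ge_zero[of p] by linarith
    have zeta: "norm (coupling E x $ k) \<le> (\<Sum>i\<in>UNIV. \<bar>E $ i $ k\<bar> * r)" for k
      unfolding coupling_def vec_lambda_beta using comp
      by (intro order_trans[OF norm_sum] sum_mono) (simp add: mult_left_mono)
    have d: "norm (z $ k + \<beta> k *\<^sub>R coupling E x $ k) \<le> Cz k" for k
      unfolding Cz_def using beta_pos[of k]
      by (intro norm_triangle_le add_mono comp) (simp add: zeta)
    let ?v = "\<lambda>i. - \<alpha> i *\<^sub>R (\<D> i (lam $ i) (mu $ i) (x $ i)
        + (\<Sum>k\<in>UNIV. E $ i $ k *\<^sub>R (z $ k + \<beta> k *\<^sub>R coupling E x $ k)))"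
    have "norm (agent_outputs (closed_loop f g h Cin Ceq \<alpha> \<beta> E p)) \<le> (\<Sum>i\<in>UNIV. norm (?v i))"
      unfolding p_eq closed_loop_eq agent_outputs_def fst_conv norm_vec_def vec_lambda_beta
      by (rule L2_set_le_sum) simp
    also have "\<dots> \<le> (\<Sum>i\<in>UNIV. \<alpha> i * (C * (1 + r) + (\<Sum>k\<in>UNIV. \<bar>E $ i $ k\<bar> * Cz k)))"
    proof (rule sum_mono)
      fix i
      have "norm (\<Sum>k\<in>UNIV. E $ i $ k *\<^sub>R (z $ k + \<beta> k *\<^sub>R coupling E x $ k)) \<le> (\<Sum>k\<in>UNIV. \<bar>E $ i $ k\<bar> * Cz k)"
        using d by (intro order_trans[OF norm_sum] sum_mono) (simp add: mult_left_mono)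
      then have "norm (\<D> i (lam $ i) (mu $ i) (x $ i)
        + (\<Sum>k\<in>UNIV. E $ i $ k *\<^sub>R (z $ k + \<beta> k *\<^sub>R coupling E x $ k)))
          \<le> C * (1 + r) + (\<Sum>k\<in>UNIV. \<bar>E $ i $ k\<bar> * Cz k)"
        by (intro norm_triangle_le add_mono C(2) \<open>0 \<le> r\<close> comp)
      then show "norm (?v i) \<le> \<alpha> i * (C * (1 + r) + (\<Sum>k\<in>UNIV. \<bar>E $ i $ k\<bar> * Cz k))"
        using alpha_pos[of i] by simp
    qed
    finally show ?thesis .
  qed
  then show ?thesis by blast
qed

section \<open>Stability and convergence of the consensus output\<close>

lemma consensus_stable:
  "output_globally_asymptotically_stable
     (closed_loop f g h Cin Ceq \<alpha> \<beta> E) (state_space Cin Ceq) agent_outputs (\<chi> i. ystar)"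
proof -
  let ?F = "closed_loop f g h Cin Ceq \<alpha> \<beta> E" and ?S = "state_space Cin Ceq"
  have out: "bounded_linear (agent_outputs :: ('n, 'a, 'l, 'm, 'k) state \<Rightarrow> _)"
    unfolding agent_outputs_def by (rule bounded_linear_fst)
  obtain \<kappa> where \<kappa>: "\<kappa> > 0" "\<And>p. \<kappa> * (norm p)\<^sup>2 \<le> energy p p" using energy_coercive by blast
  \<comment> \<open>Every equilibrium provides its own energy and rate. Stability is shown for each
    of them, while convergence of the output follows from a single one.\<close>
  have lyapunov: "quadratic_lyapunov energy \<kappa> ?F ?S (x, lam, mu, z) agent_outputs (dissipation_rate lam mu z)"
    if "equilibrium ?F ?S (x, lam, mu, z)" for x lam mu z
    using energy_dissipation[OF equilibrium_data(2-4)[OF that]]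
      dissipation_rate_nonneg[OF equilibrium_data(2-4)[OF that]] equilibrium_data(1)[OF that]
    by (intro quadratic_lyapunov.intro energy_bounded_bilinear energy_sym \<kappa>) auto
  obtain x lam mu z where e: "equilibrium ?F ?S (x, lam, mu, z)"
    using equilibrium_exists by (metis prod_cases4)
  have "((\<lambda>t. agent_outputs (s t)) \<longlongrightarrow> (\<chi> i. ystar)) at_top" if "caratheodory_solution ?F ?S s" for s
    using quadratic_lyapunov.output_tendsto[OF lyapunov[OF e] out agent_velocity_bounded
        dissipation_rate_continuous dissipation_rate_zero[OF equilibrium_data(2-4)[OF e]] that] .
  moreover have "agent_outputs p = (\<chi> i. ystar) \<and> lyapunov_stable ?F ?S p" if "equilibrium ?F ?S p" for p
  proof -
    obtain x lam mu z where p: "p = (x, lam, mu, z)" by (cases p) auto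
    show ?thesis
      using equilibrium_data(1) quadratic_lyapunov.lyapunov_stable[OF lyapunov] that
      unfolding p agent_outputs_def by auto
  qed
  ultimately show ?thesis
    unfolding output_globally_asymptotically_stable_def using e by blast
qed

end

theorem theorem30:
  fixes f :: "'a::finite \<Rightarrow> real^'n::finite \<Rightarrow> real"
    and g :: "'a \<Rightarrow> 'l::finite \<Rightarrow> real^'n \<Rightarrow> real"
    and h :: "'a \<Rightarrow> 'm::finite \<Rightarrow> real^'n \<Rightarrow> real"
    and a :: "'a \<Rightarrow> 'm \<Rightarrow> real^'n"
    and c :: "'a \<Rightarrow> 'm \<Rightarrow> real"
    and Cin :: "'a \<Rightarrow> 'l set"
    and Ceq :: "'a \<Rightarrow> 'm set"
    and \<alpha> :: "'a \<Rightarrow> real"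
    and \<beta> :: "'k::finite \<Rightarrow> real"
    and E :: "real^'k^'a"
    and ystar :: "real^'n"
  assumes f_differentiable: "\<And>i y. f i differentiable (at y)"
    and g_differentiable: "\<And>i l y. l \<in> Cin i \<Longrightarrow> g i l differentiable (at y)"
    and f_lipschitz: "\<And>i. \<exists>L. L-lipschitz_on UNIV (f i)"
    and g_lipschitz: "\<And>i l. l \<in> Cin i \<Longrightarrow> \<exists>L. L-lipschitz_on UNIV (g i l)"
    and h_lipschitz: "\<And>i j. j \<in> Ceq i \<Longrightarrow> \<exists>L. L-lipschitz_on UNIV (h i j)"
    and f_convex: "\<And>i. convex_on UNIV (f i)"
    and g_convex: "\<And>i l. l \<in> Cin i \<Longrightarrow> convex_on UNIV (g i l)"
    and h_affine: "\<And>i j y. j \<in> Ceq i \<Longrightarrow> h i j y = a i j \<bullet> y + c i j"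
    and sum_strictly_convex: "strictly_convex_on UNIV (\<lambda>y. \<Sum>i\<in>UNIV. f i y)"
    and slater: "slater g h Cin Ceq"
    and minimizer: "is_arg_min (\<lambda>y. \<Sum>i\<in>UNIV. f i y) (feasible g h Cin Ceq) ystar"
    and alpha_pos: "\<And>i. 0 < \<alpha> i"
    and beta_pos: "\<And>k. 0 < \<beta> k"
    and ker_E: "{v. transpose E *v v = 0} = {r *\<^sub>R 1 |r. True}"
  shows "output_globally_asymptotically_stable
           (closed_loop f g h Cin Ceq \<alpha> \<beta> E) (state_space Cin Ceq)
           agent_outputs (\<chi> i. ystar)"
proof -
  interpret distributed_optimization f g h a c Cin Ceq \<alpha> \<beta> E ystar
    by (rule distributed_optimization.intro) (fact assms)+
  show ?thesis by (rule consensus_stable)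
qed

end
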